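(* For any $n,\mathcal D\in\mathbb N$ and any distribution estimator $\hat p'$, there is a distribution $p$ such that, with probability at least $9/10$ (over an i.i.d. sample $X^n\sim p$), we have both \[ \mathcal O(\log n+\mathcal D)\ge\mathcal D_n \] and \[ \ell_{\mathrm{KL}}(p,\hat p'_{X^n})-\min_{\hat p\in\mathcal N}\ell_{\mathrm{KL}}(p,\hat p_{X^n})\ge\Omega\left(\frac{\mathcal D}{n}\right). \]
   Context: Distributions are discrete distributions over a finite or countably infinite alphabet $\mathcal X$. The multiplicity of a symbol in a sequence $x^n$ over $\mathcal X$ is the number of times it appears in $x^n$; the profile $\varphi(x^n)$ is the multiset of multiplicities of the symbols appearing in $x^n$. $\mathcal D_n$ is the profile dimension of the sample $X^n\sim p$, i.e. the number of distinct elements in the multiset $\varphi(X^n)$ (while $\mathcal D$ without subscript is the given number). A distribution estimator $\hat p$ associates with every sequence $x^n$ over $\mathcal X$ a distribution $\hat p_{x^n}$ over $\mathcal X$; it is natural if it assigns the same probability to symbols appearing an equal number of times in $x^n$. $\mathcal N$ is the collection of all natural estimators; the minimum over $\mathcal N$ is the loss of the best natural estimator, which may be designed with knowledge of the true distribution $p$. $\ell_{\mathrm{KL}}(p,q)=\sum_{x}p_x\log(p_x/q_x)$ is the KL divergence. $\mathcal O$ and $\Omega$ are standard asymptotic notation hiding absolute constants.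
   Formalization: Assumes n ≥ 1, an alphabet with at least two symbols, D equal to the profile dimension of some length-n sequence over it, and, for an infinite alphabet, n above an absolute constant; the best natural loss is also shown finite on the event. *)

theory Defs
  imports "HOL-Probability.Probability"
begin

definition seqs :: "'a set \<Rightarrow> nat \<Rightarrow> 'a list set" where
  "seqs X n = {xs. set xs \<subseteq> X \<and> length xs = n}"

definition profile :: "'a list \<Rightarrow> nat multiset" where
  "profile xs = image_mset (count_list xs) (mset_set (set xs))"

definition profile_dim :: "'a list \<Rightarrow> nat" where
  "profile_dim xs = card (set_mset (profile xs))"

(* The negative parts of the terms p x * ln (p x / q x) always have a finite sum, so if the
   series is not (absolutely) summable, its value is +infinity. Terms with p x = 0 count as 0,
   and p x > 0 = q x gives +infinity. *)
definition KL :: "'a pmf \<Rightarrow> 'a pmf \<Rightarrow> ereal" where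
  "KL p q =
     (if set_pmf p \<subseteq> set_pmf q \<and>
         (\<lambda>x. pmf p x * ln (pmf p x / pmf q x)) summable_on set_pmf p
      then ereal (\<Sum>\<^sub>\<infinity>x\<in>set_pmf p. pmf p x * ln (pmf p x / pmf q x))
      else \<infinity>)"

(* Only the values on sequences of the sample length n matter. *)
definition estimator :: "'a set \<Rightarrow> nat \<Rightarrow> ('a list \<Rightarrow> 'a pmf) \<Rightarrow> bool" where
  "estimator X n q \<longleftrightarrow> (\<forall>xs\<in>seqs X n. set_pmf (q xs) \<subseteq> X)"

(* Symbols of X that do not occur in xs all have multiplicity 0 and hence also share one
   probability; if X is infinite, that probability is 0. *)
definition natural_estimators :: "'a set \<Rightarrow> nat \<Rightarrow> ('a list \<Rightarrow> 'a pmf) set" where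
  "natural_estimators X n =
     {q. estimator X n q \<and>
         (\<forall>xs\<in>seqs X n. \<forall>x\<in>X. \<forall>y\<in>X.
            count_list xs x = count_list xs y \<longrightarrow> pmf (q xs) x = pmf (q xs) y)}"

(* For n > 0 and p supported in X the infimum is a minimum: if it is finite, it is attained by
   averaging p over the symbols of equal multiplicity, and if it is infinite, every natural
   estimator attains it. *)
definition best_natural_loss :: "'a set \<Rightarrow> nat \<Rightarrow> 'a pmf \<Rightarrow> 'a list \<Rightarrow> ereal" where
  "best_natural_loss X n p xs = (INF q\<in>natural_estimators X n. KL p (q xs))"

end

theory Submission
  imports Defs
begin

text \<open>
  Take \<open>k \<approx> D\<close> light symbols and one heavy symbol that carries the remaining mass. The numbers
  \<open>sqrt (n p x)\<close> of the light symbols are placed on an arithmetic progression from \<open>base = sqrt (A k)\<close> to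
  \<open>2 base\<close>, and each is shifted by an independent random point of a fine grid in \<open>[0, 1/5]\<close>.
  At most \<open>k + 1\<close> symbols occur, which bounds the profile dimension.

  Shifts of this size change the law of the sample only by a bounded \<open>\<chi>\<^sup>2\<close>-divergence, so for every
  light symbol the shift is identified with small probability, and by the Hellinger lower bound
  \<open>KL p (q X) \<ge> \<Sum>x. (sqrt (p x) - sqrt (q x))\<^sup>2\<close> any estimator typically loses a constant over \<open>n\<close> at half
  of the light symbols. The best natural estimator is at least as good as averaging \<open>p\<close> over symbols of
  equal multiplicity, which only loses at tied symbols. Two symbols \<open>x, y\<close> tie with probability at most
  \<open>exp (- n (sqrt (p x) - sqrt (p y))\<^sup>2)\<close> divided by the order of \<open>base\<close>, so the expected loss is
  \<open>O(k / (A n))\<close>, which is negligible for large \<open>A\<close>.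

  For bounded \<open>n\<close> the alphabet is finite, and two distributions that almost always produce a
  constant sequence suffice.
\<close>

section \<open>Multinomial weights\<close>

text \<open>The probability of an i.i.d. sample under \<open>w\<close>. Plain functions in place of
  a \<open>pmf\<close> also cover tilted weights and squared likelihood ratios, which need not sum
  to one.\<close>

abbreviation weight :: "('a \<Rightarrow> real) \<Rightarrow> 'a list \<Rightarrow> real" where
  "weight w xs \<equiv> prod_list (map w xs)"

lemma finite_seqs: "finite S \<Longrightarrow> finite (seqs S n)"
  unfolding seqs_def by (rule finite_lists_length_eq)

lemma seqs_0 [simp]: "seqs S 0 = {[]}"
  by (auto simp: seqs_def)

lemma sum_seqs_Suc:
  assumes "finite S"
  shows "(\<Sum>xs\<in>seqs S (Suc n). f xs) = (\<Sum>x\<in>S. \<Sum>xs\<in>seqs S n. f (x # xs))"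
proof -
  have "seqs S (Suc n) = (\<lambda>(x, xs). x # xs) ` (S \<times> seqs S n)"
    by (auto simp: seqs_def length_Suc_conv image_iff)
  moreover have "inj_on (\<lambda>(x, xs). x # xs) (S \<times> seqs S n)"
    by (auto simp: inj_on_def)
  ultimately show ?thesis
    by (simp add: sum.reindex sum.cartesian_product case_prod_unfold)
qed

lemma sum_weight:
  assumes "finite S"
  shows "(\<Sum>xs\<in>seqs S n. weight w xs) = (\<Sum>x\<in>S. w x) ^ n"
  by (induction n) (simp_all add: sum_seqs_Suc[OF assms] flip: sum_distrib_left sum_distrib_right)

lemma weight_nonneg:
  assumes "\<And>x. x \<in> S \<Longrightarrow> 0 \<le> w x" "xs \<in> seqs S n"
  shows "0 \<le> weight w xs"
proof -
  have "set xs \<subseteq> S \<Longrightarrow> 0 \<le> weight w xs" for xs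
    using assms(1) by (induction xs) auto
  with assms(2) show ?thesis by (auto simp: seqs_def)
qed

lemma weight_pos:
  assumes "\<And>x. x \<in> S \<Longrightarrow> 0 < w x" "xs \<in> seqs S n"
  shows "0 < weight w xs"
proof -
  have "set xs \<subseteq> S \<Longrightarrow> 0 < weight w xs" for xs
    using assms(1) by (induction xs) auto
  with assms(2) show ?thesis by (auto simp: seqs_def)
qed

section \<open>Exponential tail bounds for the count of one symbol\<close>

lemma weight_exp_count:
  "weight w xs * exp ((a::real) * count_list xs i) = weight (\<lambda>x. w x * (if x = i then exp a else 1)) xs"
  by (induction xs) (simp_all add: algebra_simps exp_add)

text \<open>Tilting multiplies the weight of \<open>i\<close> by \<open>exp a\<close>;
  \<open>1 + y \<le> exp y\<close> then compares the binomial moment generating function with the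
  Poisson one.\<close>

lemma sum_weight_exp_count:
  fixes w :: "'a \<Rightarrow> real" and a :: real
  assumes "finite S" "i \<in> S" "(\<Sum>x\<in>S. w x) = 1" "\<And>x. x \<in> S \<Longrightarrow> 0 \<le> w x"
  shows "(\<Sum>xs\<in>seqs S n. weight w xs * exp (a * count_list xs i)) \<le> exp (n * w i * (exp a - 1))"
proof -
  have "(\<Sum>x\<in>S. w x * (if x = i then exp a else 1)) = 1 + w i * (exp a - 1)"
    using assms by (simp add: sum.remove algebra_simps)
  moreover have "0 \<le> (\<Sum>x\<in>S. w x * (if x = i then exp a else 1))"
    using assms by (intro sum_nonneg) auto
  moreover have "1 + w i * (exp a - 1) \<le> exp (w i * (exp a - 1))"
    by simp
  ultimately have "(\<Sum>x\<in>S. w x * (if x = i then exp a else 1)) ^ n \<le> exp (w i * (exp a - 1)) ^ n"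
    by (intro power_mono) simp_all
  then show ?thesis
    using assms by (simp add: weight_exp_count sum_weight exp_of_nat_mult[symmetric] algebra_simps)
qed

text \<open>Exponential Markov inequality; the sign of \<open>a\<close> selects the tail.\<close>

lemma chernoff:
  fixes w :: "'a \<Rightarrow> real" and a b :: real
  assumes S: "finite S" "i \<in> S" "(\<Sum>x\<in>S. w x) = 1" "\<And>x. x \<in> S \<Longrightarrow> 0 \<le> w x"
    and E: "\<And>xs. xs \<in> E \<Longrightarrow> xs \<in> seqs S n \<and> b \<le> a * count_list xs i"
  shows "(\<Sum>xs\<in>E. weight w xs) \<le> exp (n * w i * (exp a - 1) - b)"
proof -
  have E': "E \<subseteq> seqs S n" using E by auto
  have nonneg: "0 \<le> weight w xs" if "xs \<in> seqs S n" for xs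
    using weight_nonneg[OF S(4) that] .
  have "(\<Sum>xs\<in>E. weight w xs) \<le> (\<Sum>xs\<in>E. weight w xs * exp (a * count_list xs i - b))"
  proof (rule sum_mono)
    fix xs assume xs: "xs \<in> E"
    then have "weight w xs * 1 \<le> weight w xs * exp (a * count_list xs i - b)"
      using E E' nonneg by (intro mult_left_mono) auto
    then show "weight w xs \<le> weight w xs * exp (a * count_list xs i - b)" by simp
  qed
  also have "\<dots> \<le> (\<Sum>xs\<in>seqs S n. weight w xs * exp (a * count_list xs i - b))"
    using nonneg by (intro sum_mono2 finite_seqs S E') auto
  also have "\<dots> = (\<Sum>xs\<in>seqs S n. weight w xs * exp (a * count_list xs i)) * exp (- b)"
    unfolding sum_distrib_right by (simp add: exp_diff exp_minus divide_inverse mult.assoc)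
  also have "\<dots> \<le> exp (n * w i * (exp a - 1)) * exp (- b)"
    by (intro mult_right_mono sum_weight_exp_count S) auto
  finally show ?thesis
    by (simp add: exp_diff exp_minus divide_inverse)
qed

lemma count_upper_tail:
  fixes w :: "'a \<Rightarrow> real"
  assumes S: "finite S" "i \<in> S" "(\<Sum>x\<in>S. w x) = 1" "\<And>x. x \<in> S \<Longrightarrow> 0 \<le> w x"
  shows "(\<Sum>xs | xs \<in> seqs S n \<and> count_list xs i > 4 * (n * w i). weight w xs) \<le> exp (- (n * w i))"
proof -
  have "(\<Sum>xs | xs \<in> seqs S n \<and> count_list xs i > 4 * (n * w i). weight w xs)
      \<le> exp (n * w i * (exp 1 - 1) - 4 * (n * w i))"
    using S by (intro chernoff) auto
  also have "\<dots> \<le> exp (- (n * w i))"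
  proof -
    have "n * w i * exp 1 \<le> n * w i * 4"
      using S exp_le by (intro mult_left_mono) auto
    then show ?thesis by (simp add: algebra_simps)
  qed
  finally show ?thesis .
qed

lemma count_lower_tail:
  fixes w :: "'a \<Rightarrow> real"
  assumes S: "finite S" "i \<in> S" "(\<Sum>x\<in>S. w x) = 1" "\<And>x. x \<in> S \<Longrightarrow> 0 \<le> w x"
  shows "(\<Sum>xs | xs \<in> seqs S n \<and> count_list xs i < (n * w i) / 4. weight w xs) \<le> exp (- (n * w i / 4))"
proof -
  \<comment> \<open>The lower tail uses \<open>a = - 1\<close>; the exponent works out because
    \<open>exp (- 1) - 1 + 1 / 4 \<le> - 1 / 4\<close>.\<close>
  have "(\<Sum>xs | xs \<in> seqs S n \<and> count_list xs i < (n * w i) / 4. weight w xs)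
      \<le> exp (n * w i * (exp (- 1) - 1) - - (n * w i / 4))"
    using S by (intro chernoff) auto
  also have "\<dots> \<le> exp (- (n * w i / 4))"
  proof -
    have "(2::real) \<le> exp 1" using exp_ge_add_one_self[of 1] by simp
    then have "exp (- 1) \<le> (1 / 2 :: real)" by (simp add: exp_minus field_simps)
    then have "n * w i * exp (-1) \<le> n * w i * (1 / 2)"
      using S by (intro mult_left_mono) auto
    then show ?thesis by (simp add: algebra_simps)
  qed
  finally show ?thesis .
qed

section \<open>The probability that two symbols tie\<close>

text \<open>Induction on \<open>n\<close> over the first symbol, with Pascal's rule. The coefficient
  separates which positions carry \<open>i\<close> or \<open>j\<close> from how the two share them;
  for \<open>a = b\<close> this isolates a central binomial coefficient.\<close>

lemma sum_weight_two_counts: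
  fixes w :: "'a \<Rightarrow> real"
  assumes S: "finite S" "i \<in> S" "j \<in> S" "i \<noteq> j"
  shows "(\<Sum>xs | xs \<in> seqs S n \<and> count_list xs i = a \<and> count_list xs j = b. weight w xs)
    = ((a + b) choose a) * (w i ^ a * w j ^ b) * ((n choose (a + b)) * (\<Sum>x\<in>S - {i, j}. w x) ^ (n - (a + b)))"
proof -
  define r where "r = (\<Sum>x\<in>S - {i, j}. w x)"
  define W where "W n a b = (\<Sum>xs\<in>seqs S n. if count_list xs i = a \<and> count_list xs j = b then weight w xs else 0)"
    for n a b
  \<comment> \<open>The first symbol is \<open>i\<close>, \<open>j\<close> or another one. It cannot
    be \<open>i\<close> if \<open>a = 0\<close>, nor \<open>j\<close> if
    \<open>b = 0\<close>.\<close>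
  have W_Suc: "W (Suc n) a b = (if a = 0 then 0 else w i * W n (a - 1) b)
     + (if b = 0 then 0 else w j * W n a (b - 1)) + r * W n a b" for n a b
  proof -
    define T where "T x = (\<Sum>xs\<in>seqs S n. if count_list (x # xs) i = a \<and> count_list (x # xs) j = b
      then weight w (x # xs) else 0)" for x
    have "S = insert i (insert j (S - {i, j}))" using S by auto
    then have "W (Suc n) a b = T i + (T j + (\<Sum>x\<in>S - {i, j}. T x))"
      unfolding W_def sum_seqs_Suc[OF S(1)] T_def[symmetric] using S
      by (metis (no_types, lifting) Diff_iff finite_Diff finite_insert insert_iff sum.insert)
    moreover have "T i = (if a = 0 then 0 else w i * W n (a - 1) b)"
      using S by (auto simp: T_def W_def sum_distrib_left intro!: sum.cong)
    moreover have "T j = (if b = 0 then 0 else w j * W n a (b - 1))"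
      using S by (auto simp: T_def W_def sum_distrib_left intro!: sum.cong)
    moreover have "(\<Sum>x\<in>S - {i, j}. T x) = r * W n a b"
      unfolding r_def sum_distrib_right
      by (intro sum.cong) (auto simp: T_def W_def sum_distrib_left intro!: sum.cong)
    ultimately show ?thesis by simp
  qed
  have pow: "r * (real (n choose s) * r ^ (n - s)) = real (n choose s) * r ^ (Suc n - s)" for n s
    by (cases "s \<le> n") (simp_all add: Suc_diff_le)
  have "W n a b = ((a + b) choose a) * (w i ^ a * w j ^ b) * ((n choose (a + b)) * r ^ (n - (a + b)))"
  proof (induction n arbitrary: a b)
    case 0
    show ?case by (cases a; cases b) (auto simp: W_def)
  next
    case (Suc n)
    define R where "R s = real (n choose s) * r ^ (n - s)" for s
    have IH: "W n a b = ((a + b) choose a) * (w i ^ a * w j ^ b) * R (a + b)" for a b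
      using Suc.IH unfolding R_def by blast
    have R: "r * R s = real (n choose s) * r ^ (Suc n - s)" for s
      unfolding R_def by (rule pow)
    \<comment> \<open>Pascal's rule in \<open>n\<close>; the one for \<open>(a + b) choose a\<close>
      enters in the case distinction on \<open>a\<close> and \<open>b\<close>.\<close>
    have R2: "(Suc n choose Suc s) * r ^ (Suc n - Suc s) = R s + r * R (Suc s)" for s
      unfolding R by (simp add: R_def algebra_simps)
    show ?case
    proof (cases "a + b")
      case 0
      then show ?thesis
        using R[of 0] by (simp add: W_Suc IH)
    next
      case (Suc s)
      have "W (Suc n) a b = ((a + b) choose a) * (w i ^ a * w j ^ b) * (R s + r * R (Suc s))"
      proof (cases a)
        case 0
        with Suc show ?thesis by (simp add: W_Suc IH algebra_simps)
      next
        case a: (Suc a')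
        show ?thesis
        proof (cases b)
          case 0
          with a Suc show ?thesis by (simp add: W_Suc IH algebra_simps)
        next
          case b: (Suc b')
          from a b Suc have s: "s = Suc (a' + b')" by simp
          show ?thesis unfolding s a b
            by (simp add: W_Suc IH algebra_simps)
        qed
      qed
      then show ?thesis unfolding Suc R2 .
    qed
  qed
  then show ?thesis
    using S finite_seqs[OF S(1)] by (simp add: W_def r_def sum.If_cases Int_def conj_ac)
qed

text \<open>Induction on the squared claim: consecutive central binomial coefficients have ratio
  \<open>2 * (2 * m + 1) / (m + 1)\<close>, and
  \<open>(2 * m + 1) * (2 * m + 3) \<le> 4 * (m + 1)\<^sup>2\<close>.\<close>

lemma central_binomial_le: "real ((2 * m) choose m) * sqrt (2 * m + 1) \<le> 4 ^ m"
proof -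
  have "real ((2 * m) choose m) ^ 2 * (2 * m + 1) \<le> 16 ^ m"
  proof (induction m)
    case (Suc m)
    define c where "c = real ((2 * m) choose m)"
    define d where "d = real ((2 * Suc m) choose Suc m)"
    have "(m + 1) * (2 * Suc m choose Suc m) = 2 * (2 * m + 1) * ((2 * m) choose m)"
    proof -
      have "Suc m * (2 * Suc m choose Suc m) = 2 * Suc m * (Suc (2 * m) choose m)"
        using Suc_times_binomial[of m "Suc (2*m)"] by simp
      moreover have "Suc (2 * m) choose m = Suc (2 * m) choose Suc m"
        using binomial_symmetric[of m "Suc (2 * m)"] by simp
      moreover have "Suc m * (Suc (2 * m) choose Suc m) = Suc (2 * m) * (2 * m choose m)"
        by (rule Suc_times_binomial)
      ultimately have "Suc m * (2 * Suc m choose Suc m) = 2 * (Suc (2 * m) * (2 * m choose m))"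
        by (metis mult.assoc)
      then show ?thesis by simp
    qed
    then have "real ((m + 1) * (2 * Suc m choose Suc m)) = real (2 * (2 * m + 1) * ((2 * m) choose m))"
      by (rule arg_cong)
    moreover define x where "x = real m"
    ultimately have d: "(x + 1) * d = 2 * (2 * x + 1) * c"
      unfolding c_def d_def of_nat_mult by (simp del: binomial_Suc_Suc add: add.commute)
    have IH: "c ^ 2 * (2 * x + 1) \<le> 16 ^ m" using Suc unfolding c_def x_def by (simp add: add.commute)
    have x: "real (2 * Suc m + 1) = 2 * x + 3" "0 \<le> x" by (simp_all add: x_def)
    have "(x + 1)^2 * (d ^ 2 * (2 * x + 3)) = ((x + 1) * d)^2 * (2 * x + 3)"
      by algebra
    also have "\<dots> = (c^2 * (2 * x + 1)) * (4 * ((2 * x + 1) * (2 * x + 3)))"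
      unfolding d by algebra
    also have "\<dots> \<le> 16 ^ m * (16 * (x + 1)^2)"
    proof (rule mult_mono[OF IH])
      show "4 * ((2 * x + 1) * (2 * x + 3)) \<le> 16 * (x + 1)\<^sup>2"
        by (simp add: power2_eq_square algebra_simps)
    qed (use x(2) in auto)
    also have "\<dots> = (x + 1)^2 * 16 ^ Suc m" by simp
    finally have le: "(x + 1)^2 * (d ^ 2 * (2 * x + 3)) \<le> (x + 1)^2 * 16 ^ Suc m" .
    have "0 < (x + 1)^2" using x by simp
    with le have "d ^ 2 * (2 * x + 3) \<le> 16 ^ Suc m"
      by (simp only: mult_le_cancel_left_pos)
    then show ?case
      unfolding d_def x .
  qed simp
  moreover have "(real ((2 * m) choose m) * sqrt (2 * m + 1))\<^sup>2 = real ((2 * m) choose m) ^ 2 * (2 * m + 1)"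
    by (simp add: power_mult_distrib)
  moreover have "(16::real) ^ m = (4 ^ m)\<^sup>2" by (simp add: power2_eq_square flip: power_mult_distrib)
  ultimately show ?thesis
    by (metis power2_le_imp_le zero_le_numeral zero_le_power)
qed

text \<open>A tie at count \<open>m\<close> carries a central binomial coefficient, at most
  \<open>4 ^ m / sqrt c\<close>. With \<open>g\<close> the geometric mean of \<open>w i\<close> and
  \<open>w j\<close>, what remains are even terms of the binomial expansion of
  \<open>(2 * g + r) ^ n\<close>, whose base is
  \<open>1 - (sqrt (w i) - sqrt (w j))\<^sup>2\<close>.\<close>

lemma tie_weight_le:
  fixes w :: "'a \<Rightarrow> real" and c :: real
  assumes S: "finite S" "i \<in> S" "j \<in> S" "i \<noteq> j" "(\<Sum>x\<in>S. w x) = 1" "\<And>x. x \<in> S \<Longrightarrow> 0 \<le> w x"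
    and c: "0 < c"
  shows "(\<Sum>xs | xs \<in> seqs S n \<and> count_list xs i = count_list xs j \<and> c \<le> 2 * count_list xs i + 1. weight w xs)
    \<le> exp (- (n * (sqrt (w i) - sqrt (w j))\<^sup>2)) / sqrt c"
proof -
  define g r where "g = sqrt (w i) * sqrt (w j)" and "r = (\<Sum>x\<in>S - {i, j}. w x)"
  have g: "0 \<le> g" "g ^ 2 = w i * w j"
    unfolding g_def using S by (auto simp: power_mult_distrib)
  have r: "0 \<le> r" unfolding r_def using S by (intro sum_nonneg) auto
  have "S = insert i (insert j (S - {i, j}))" using S by auto
  then have "(\<Sum>x\<in>S. w x) = w i + (w j + r)"
    unfolding r_def using S
    by (metis (no_types, lifting) Diff_iff finite_Diff finite_insert insert_iff sum.insert)
  then have sum: "w i + w j + r = 1" using S by simp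
  define E where "E m = {xs \<in> seqs S n. count_list xs i = m \<and> count_list xs j = m}" for m
  define I where "I = {m. m \<le> n \<and> c \<le> 2 * real m + 1}"
  define t where "t s = real (n choose s) * (2 * g) ^ s * r ^ (n - s)" for s
  have fin: "finite I" unfolding I_def by simp
  have count_le: "count_list xs x \<le> n" if "xs \<in> seqs S n" for xs x
    using that count_le_length[of xs x] by (auto simp: seqs_def)
  have "{xs. xs \<in> seqs S n \<and> count_list xs i = count_list xs j \<and> c \<le> 2 * count_list xs i + 1} = (\<Union>m\<in>I. E m)"
    unfolding E_def I_def using count_le by (auto simp: algebra_simps)
  then have "(\<Sum>xs | xs \<in> seqs S n \<and> count_list xs i = count_list xs j \<and> c \<le> 2 * count_list xs i + 1. weight w xs)
      = (\<Sum>m\<in>I. \<Sum>xs\<in>E m. weight w xs)"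
    using fin finite_seqs[OF S(1), of n] by (simp only:, subst sum.UNION_disjoint) (auto simp: E_def)
  also have "\<dots> \<le> (\<Sum>m\<in>I. t (2 * m) / sqrt c)"
  proof (rule sum_mono)
    fix m assume m: "m \<in> I"
    have "(\<Sum>xs\<in>E m. weight w xs) = ((2 * m) choose m) * (w i * w j) ^ m * ((n choose (2 * m)) * r ^ (n - 2 * m))"
      using sum_weight_two_counts[OF S(1-4), of w n m m]
      unfolding E_def r_def by (simp add: mult_2 power_mult_distrib)
    moreover have "real ((2 * m) choose m) \<le> 4 ^ m / sqrt c"
    proof -
      have "real ((2 * m) choose m) * sqrt c \<le> real ((2 * m) choose m) * sqrt (2 * m + 1)"
        using m by (intro mult_left_mono) (auto simp: I_def)
      also have "\<dots> \<le> 4 ^ m" by (rule central_binomial_le)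
      finally show ?thesis using c by (simp add: field_simps)
    qed
    ultimately have "(\<Sum>xs\<in>E m. weight w xs)
        \<le> 4 ^ m / sqrt c * (w i * w j) ^ m * ((n choose (2 * m)) * r ^ (n - 2 * m))"
      using S r by (simp only:) (intro mult_right_mono mult_nonneg_nonneg zero_le_power; simp)
    also have "(4::real) ^ m = 2 ^ (2 * m)" by (simp add: power_mult)
    finally show "(\<Sum>xs\<in>E m. weight w xs) \<le> t (2 * m) / sqrt c"
      unfolding t_def g(2)[symmetric] by (simp add: power_mult_distrib mult_ac flip: power_mult)
  qed
  also have "\<dots> = (\<Sum>s\<in>(\<lambda>m. 2 * m) ` I. t s) / sqrt c"
    by (simp add: sum.reindex inj_on_def sum_divide_distrib)
  \<comment> \<open>All missing nonnegative terms are added. Indices beyond \<open>n\<close> may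
    occur, but the binomial coefficient vanishes there.\<close>
  also have "(\<Sum>s\<in>(\<lambda>m. 2 * m) ` I. t s) \<le> (\<Sum>s\<in>{..n} \<union> (\<lambda>m. 2 * m) ` I. t s)"
    using fin g r by (intro sum_mono2) (auto simp: t_def)
  also have "\<dots> = (\<Sum>s\<le>n. t s)"
    using fin by (intro sum.mono_neutral_right) (auto simp: t_def)
  also have "\<dots> = (2 * g + r) ^ n"
    unfolding t_def by (rule binomial_ring[symmetric])
  also have "2 * g + r = 1 - (sqrt (w i) - sqrt (w j))\<^sup>2"
    using sum S by (simp add: g_def power2_diff)
  also have "(1 - (sqrt (w i) - sqrt (w j))\<^sup>2) ^ n \<le> exp (- (sqrt (w i) - sqrt (w j))\<^sup>2) ^ n"
  proof (rule power_mono)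
    show "0 \<le> 1 - (sqrt (w i) - sqrt (w j))\<^sup>2"
      using \<open>2 * g + r = _\<close> g r by simp
    show "1 - (sqrt (w i) - sqrt (w j))\<^sup>2 \<le> exp (- (sqrt (w i) - sqrt (w j))\<^sup>2)"
      using exp_ge_add_one_self[of "- (sqrt (w i) - sqrt (w j))\<^sup>2"] by simp
  qed
  finally show ?thesis
    using c by (simp add: divide_right_mono exp_of_nat_mult[symmetric])
qed

text \<open>At every outcome at most one of the hypotheses is selected, and
  \<open>P v \<le> \<theta> P\<^sub>0 + (P v)\<^sup>2 / (4 \<theta> P\<^sub>0)\<close>.\<close>
lemma selection_bound:
  fixes P :: "'v \<Rightarrow> 'x \<Rightarrow> real"
  assumes fin: "finite V" "finite L" and P0: "\<And>x. x \<in> L \<Longrightarrow> 0 < P0 x" "(\<Sum>x\<in>L. P0 x) \<le> 1"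
    and K: "\<And>v. v \<in> V \<Longrightarrow> (\<Sum>x\<in>L. (P v x)\<^sup>2 / P0 x) \<le> K"
    and \<theta>: "0 < \<theta>"
    and sub: "\<And>v. v \<in> V \<Longrightarrow> B v \<subseteq> L"
    and disj: "\<And>v v' x. v \<in> V \<Longrightarrow> v' \<in> V \<Longrightarrow> x \<in> B v \<Longrightarrow> x \<in> B v' \<Longrightarrow> v = v'"
  shows "(\<Sum>v\<in>V. \<Sum>x\<in>B v. P v x) \<le> \<theta> + card V * (K / (4 * \<theta>))"
proof -
  have amgm: "P v x \<le> \<theta> * P0 x + (P v x)\<^sup>2 / P0 x / (4 * \<theta>)" if "x \<in> L" for v x
  proof -
    have "0 \<le> (2 * \<theta> * P0 x - P v x)\<^sup>2 / (4 * \<theta> * P0 x)"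
      using \<theta> P0(1)[OF that] by simp
    also have "\<dots> = \<theta> * P0 x + (P v x)\<^sup>2 / P0 x / (4 * \<theta>) - P v x"
      using \<theta> P0(1)[OF that] by (simp add: power2_eq_square field_simps)
    finally show ?thesis by simp
  qed
  have finB: "finite (B v)" if "v \<in> V" for v
    using sub[OF that] fin(2) finite_subset by blast
  have "(\<Sum>v\<in>V. \<Sum>x\<in>B v. P v x) \<le> (\<Sum>v\<in>V. \<theta> * (\<Sum>x\<in>B v. P0 x) + K / (4 * \<theta>))"
  proof (rule sum_mono)
    fix v assume v: "v \<in> V"
    have "(\<Sum>x\<in>B v. P v x) \<le> (\<Sum>x\<in>B v. \<theta> * P0 x + (P v x)\<^sup>2 / P0 x / (4 * \<theta>))"
      using sub[OF v] by (intro sum_mono amgm) auto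
    also have "\<dots> = \<theta> * (\<Sum>x\<in>B v. P0 x) + (\<Sum>x\<in>B v. (P v x)\<^sup>2 / P0 x) / (4 * \<theta>)"
      by (simp add: sum.distrib sum_distrib_left sum_divide_distrib)
    also have "(\<Sum>x\<in>B v. (P v x)\<^sup>2 / P0 x) \<le> (\<Sum>x\<in>L. (P v x)\<^sup>2 / P0 x)"
      using P0 fin sub[OF v] by (intro sum_mono2) (auto intro!: divide_nonneg_pos)
    also have "\<dots> \<le> K" by (rule K[OF v])
    finally show "(\<Sum>x\<in>B v. P v x) \<le> \<theta> * (\<Sum>x\<in>B v. P0 x) + K / (4 * \<theta>)"
      using \<theta> by (simp add: divide_right_mono)
  qed
  also have "\<dots> = \<theta> * (\<Sum>x\<in>(\<Union>v\<in>V. B v). P0 x) + card V * (K / (4 * \<theta>))"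
    using fin finB disj by (subst sum.UNION_disjoint) (auto simp: sum.distrib sum_distrib_left)
  also have "(\<Sum>x\<in>(\<Union>v\<in>V. B v). P0 x) \<le> (\<Sum>x\<in>L. P0 x)"
    using fin sub P0(1) by (intro sum_mono2) (auto intro: less_imp_le)
  also have "\<dots> \<le> 1" by (rule P0)
  finally show ?thesis using \<theta> by (simp add: mult_left_mono)
qed

section \<open>Divergence and natural estimators\<close>

text \<open>Apply \<open>ln u \<le> u - 1\<close> to the square root of the ratio
  \<open>q / p\<close>. The extra summand is the mass that \<open>q\<close> puts outside
  \<open>S\<close>.\<close>

lemma KL_ge_hellinger:
  fixes p q :: "'a pmf"
  assumes "finite S" "set_pmf p \<subseteq> S"
  shows "ereal ((\<Sum>x\<in>S. (sqrt (pmf p x) - sqrt (pmf q x))\<^sup>2) + (1 - (\<Sum>x\<in>S. pmf q x))) \<le> KL p q"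
proof (cases "set_pmf p \<subseteq> set_pmf q")
  case True
  have fin: "finite (set_pmf p)" using assms finite_subset by blast
  have "(sqrt (pmf p x) - sqrt (pmf q x))\<^sup>2 + (pmf p x - pmf q x)
      \<le> (if x \<in> set_pmf p then pmf p x * ln (pmf p x / pmf q x) else 0)" for x
  proof (cases "x \<in> set_pmf p")
    case False
    then show ?thesis by (simp add: set_pmf_iff)
  next
    case x: True
    then have pos: "pmf p x > 0" "pmf q x > 0" using True by (auto simp: pmf_positive)
    have "ln (sqrt (pmf q x / pmf p x)) \<le> sqrt (pmf q x / pmf p x) - 1"
      using pos by (intro ln_le_minus_one) simp
    then have "ln (pmf q x / pmf p x) \<le> 2 * (sqrt (pmf q x / pmf p x) - 1)"
      using pos by (simp add: ln_sqrt)
    then have "pmf p x * ln (pmf q x / pmf p x) \<le> pmf p x * (2 * (sqrt (pmf q x / pmf p x) - 1))"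
      using pos by (intro mult_left_mono) auto
    also have "pmf p x * sqrt (pmf q x / pmf p x) = sqrt (pmf p x) * sqrt (pmf q x)"
      using pos by (simp add: real_sqrt_divide field_simps)
    then have "pmf p x * (2 * (sqrt (pmf q x / pmf p x) - 1)) = 2 * (sqrt (pmf p x) * sqrt (pmf q x)) - 2 * pmf p x"
      by (simp add: algebra_simps)
    finally show ?thesis
      using pos x by (simp add: ln_div power2_diff algebra_simps)
  qed
  then have "(\<Sum>x\<in>S. (sqrt (pmf p x) - sqrt (pmf q x))\<^sup>2 + (pmf p x - pmf q x))
      \<le> (\<Sum>x\<in>S. if x \<in> set_pmf p then pmf p x * ln (pmf p x / pmf q x) else 0)"
    by (intro sum_mono)
  also have "\<dots> = (\<Sum>x\<in>set_pmf p. pmf p x * ln (pmf p x / pmf q x))"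
    using assms by (simp add: sum.If_cases Int_absorb1)
  also have "(\<Sum>x\<in>S. (sqrt (pmf p x) - sqrt (pmf q x))\<^sup>2 + (pmf p x - pmf q x))
      = (\<Sum>x\<in>S. (sqrt (pmf p x) - sqrt (pmf q x))\<^sup>2) + (1 - (\<Sum>x\<in>S. pmf q x))"
    using assms by (simp add: sum.distrib sum_subtractf sum_pmf_eq_1)
  finally show ?thesis
    using True fin by (simp add: KL_def)
qed (simp add: KL_def)

text \<open>Here \<open>ln u \<le> u - 1\<close> is applied to the ratio \<open>p / q\<close>
  itself; full support of \<open>q\<close> on \<open>S\<close> keeps the divergence finite.\<close>

lemma KL_le_chi_square:
  fixes p q :: "'a pmf"
  assumes S: "finite S" "set_pmf p \<subseteq> S" "set_pmf q = S"
  shows "KL p q \<le> ereal (\<Sum>x\<in>S. (pmf p x - pmf q x)\<^sup>2 / pmf q x)"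
proof -
  have "(\<Sum>x\<in>set_pmf p. pmf p x * ln (pmf p x / pmf q x)) = (\<Sum>x\<in>S. pmf p x * ln (pmf p x / pmf q x))"
    using S by (intro sum.mono_neutral_left) (auto simp: set_pmf_iff)
  also have "\<dots> \<le> (\<Sum>x\<in>S. (pmf p x - pmf q x)\<^sup>2 / pmf q x + (pmf p x - pmf q x))"
  proof (rule sum_mono)
    fix x assume "x \<in> S"
    then have q: "pmf q x > 0" using S by (auto simp: pmf_positive)
    have eq: "(pmf p x - pmf q x)\<^sup>2 / pmf q x + (pmf p x - pmf q x) = pmf p x * (pmf p x / pmf q x - 1)"
      using q by (simp add: power2_eq_square field_simps)
    show "pmf p x * ln (pmf p x / pmf q x) \<le> (pmf p x - pmf q x)\<^sup>2 / pmf q x + (pmf p x - pmf q x)"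
    proof (cases "pmf p x = 0")
      case False
      then have "pmf p x > 0" using pmf_nonneg[of p x] by linarith
      then show ?thesis unfolding eq using q
        by (intro mult_left_mono ln_le_minus_one) auto
    qed (use q in \<open>simp add: power2_eq_square\<close>)
  qed
  also have "\<dots> = (\<Sum>x\<in>S. (pmf p x - pmf q x)\<^sup>2 / pmf q x)"
    using S by (simp add: sum.distrib sum_subtractf sum_pmf_eq_1)
  finally show ?thesis
    using S finite_subset[OF S(2,1)] by (simp add: KL_def)
qed

section \<open>Samples of a finitely supported distribution\<close>

lemma pmf_replicate_pmf:
  "pmf (replicate_pmf n p) xs = (if length xs = n then weight (pmf p) xs else 0)"
proof (induction n arbitrary: xs)
  case (Suc n)
  have eq: "replicate_pmf (Suc n) p = map_pmf (\<lambda>(x, xs). x # xs) (pair_pmf p (replicate_pmf n p))"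
    by (simp add: pair_pmf_def map_bind_pmf)
  show ?case
  proof (cases xs)
    case Nil
    then show ?thesis unfolding eq by (auto simp: pmf_eq_0_set_pmf)
  next
    case (Cons y ys)
    have "pmf (replicate_pmf (Suc n) p) ((\<lambda>(x, xs). x # xs) (y, ys)) = pmf (pair_pmf p (replicate_pmf n p)) (y, ys)"
      unfolding eq by (rule pmf_map_inj') (auto simp: inj_on_def)
    then show ?thesis using Cons Suc by (simp add: pmf_pair)
  qed
qed (auto simp: pmf_return)

lemma sum_weight_pmf:
  assumes "finite S" "set_pmf p \<subseteq> S"
  shows "(\<Sum>xs\<in>seqs S n. weight (pmf p) xs) = 1"
  using assms by (simp add: sum_weight sum_pmf_eq_1)

text \<open>Stated through the complement: \<open>E\<close> may be any set of lists, while the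
  failure probability is a finite sum of weights.\<close>

lemma prob_replicate_pmf:
  assumes "finite S" "set_pmf p \<subseteq> S"
  shows "measure_pmf.prob (replicate_pmf n p) E = 1 - (\<Sum>xs\<in>seqs S n - E. weight (pmf p) xs)"
proof -
  have sub: "set_pmf (replicate_pmf n p) \<subseteq> seqs S n"
    using assms by (auto simp: set_replicate_pmf seqs_def)
  have "measure_pmf.prob (replicate_pmf n p) E = measure_pmf.prob (replicate_pmf n p) (E \<inter> seqs S n)"
    using sub by (intro measure_pmf.finite_measure_eq_AE) (auto simp: AE_measure_pmf_iff)
  also have "\<dots> = (\<Sum>xs\<in>E \<inter> seqs S n. weight (pmf p) xs)"
    using finite_seqs[OF assms(1), of n] by (subst measure_measure_pmf_finite)
      (auto simp: pmf_replicate_pmf seqs_def intro!: sum.cong)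
  also have "\<dots> = 1 - (\<Sum>xs\<in>seqs S n - E. weight (pmf p) xs)"
    using sum.Int_Diff[OF finite_seqs[OF assms(1)], of "weight (pmf p)" n E] sum_weight_pmf[OF assms, of n]
    by (simp add: Int_commute)
  finally show ?thesis .
qed

lemma pmf_with_weights:
  fixes w :: "'a \<Rightarrow> real"
  assumes "finite S" "\<And>x. x \<in> S \<Longrightarrow> 0 \<le> w x" "(\<Sum>x\<in>S. w x) = 1"
  obtains p where "\<And>x. pmf p x = (if x \<in> S then w x else 0)"
proof
  have "(\<integral>\<^sup>+ x. ennreal (if x \<in> S then w x else 0) \<partial>count_space UNIV)
      = (\<integral>\<^sup>+ x. ennreal (w x) * indicator S x \<partial>count_space UNIV)"
    by (intro nn_integral_cong) auto
  also have "\<dots> = (\<integral>\<^sup>+ x. ennreal (w x) \<partial>count_space S)"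
    by (simp add: nn_integral_count_space_indicator)
  also have "\<dots> = ennreal (\<Sum>x\<in>S. w x)"
    using assms by (simp add: nn_integral_count_space_finite sum_ennreal)
  finally show "pmf (embed_pmf (\<lambda>x. if x \<in> S then w x else 0)) x = (if x \<in> S then w x else 0)" for x
    using assms by (intro pmf_embed_pmf) auto
qed

section \<open>Upper bounds for the best natural loss\<close>

text \<open>The loss at \<open>xs\<close> depends on an estimator only through its value there. All
  other samples get their empirical distribution, which is natural and exists because
  \<open>0 < n\<close>.\<close>

lemma best_natural_loss_le:
  assumes n: "0 < n" and xs: "xs \<in> seqs X n" and r: "set_pmf r \<subseteq> X"
    and nat: "\<And>x y. x \<in> X \<Longrightarrow> y \<in> X \<Longrightarrow> count_list xs x = count_list xs y \<Longrightarrow> pmf r x = pmf r y"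
  shows "best_natural_loss X n p xs \<le> KL p r"
proof -
  define q where "q ys = (if ys = xs then r else pmf_of_multiset (mset ys))" for ys
  have mset: "mset ys \<noteq> {#}" if "ys \<in> seqs X n" for ys
    using that n by (auto simp: seqs_def)
  have "q \<in> natural_estimators X n"
    unfolding natural_estimators_def estimator_def
  proof (intro CollectI conjI ballI impI)
    fix ys assume ys: "ys \<in> seqs X n"
    then have "set ys \<subseteq> X" by (simp add: seqs_def)
    then show "set_pmf (q ys) \<subseteq> X"
      using r mset[OF ys] by (cases "ys = xs") (simp_all add: q_def set_pmf_of_multiset)
    fix x y assume xy: "x \<in> X" "y \<in> X" "count_list ys x = count_list ys y"
    show "pmf (q ys) x = pmf (q ys) y"
    proof (cases "ys = xs")
      case True
      with nat[of x y] xy show ?thesis by (simp add: q_def)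
    next
      case False
      with mset[OF ys] xy show ?thesis by (simp add: q_def count_mset)
    qed
  qed
  then have "best_natural_loss X n p xs \<le> KL p (q xs)"
    unfolding best_natural_loss_def by (rule INF_lower)
  then show ?thesis by (simp add: q_def)
qed

lemma class_average:
  fixes p :: "'a pmf" and f :: "'a \<Rightarrow> 'b"
  assumes S: "finite S" "set_pmf p = S"
  obtains r where "set_pmf r = S"
    "\<And>x. x \<in> S \<Longrightarrow> pmf r x = (\<Sum>y | y \<in> S \<and> f y = f x. pmf p y) / card {y \<in> S. f y = f x}"
proof -
  define C where "C x = {y \<in> S. f y = f x}" for x
  define w where "w x = (\<Sum>y\<in>C x. pmf p y) / card (C x)" for x
  have C: "finite (C x)" "x \<in> S \<Longrightarrow> x \<in> C x" for x
    using S(1) by (simp_all add: C_def)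
  have C_eq: "C y = C x" if "f y = f x" for x y
    using that by (simp add: C_def)
  have card: "card (C x) > 0" if "x \<in> S" for x
    using C[of x] that by (auto simp: card_gt_0_iff)
  have pos: "w x > 0" if "x \<in> S" for x
    unfolding w_def using card[OF that] C[of x] that S
    by (intro divide_pos_pos sum_pos2[of _ x]) (auto simp: pmf_positive)
  \<comment> \<open>Double counting: each \<open>y\<close> hands out its mass in equal shares to the
    members of its class.\<close>
  have "(\<Sum>x\<in>S. w x) = (\<Sum>x\<in>S. \<Sum>y\<in>S. if f y = f x then pmf p y / card (C y) else 0)"
  proof (rule sum.cong[OF refl])
    fix x
    have "w x = (\<Sum>y\<in>C x. pmf p y / card (C y))"
      unfolding w_def sum_divide_distrib
    proof (rule sum.cong[OF refl])
      fix y assume "y \<in> C x"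
      then have "C y = C x" by (intro C_eq) (simp add: C_def)
      then show "pmf p y / card (C x) = pmf p y / card (C y)" by simp
    qed
    also have "\<dots> = (\<Sum>y\<in>S. if f y = f x then pmf p y / card (C y) else 0)"
      unfolding C_def[of x] using S(1) by (rule sum.inter_filter)
    finally show "w x = (\<Sum>y\<in>S. if f y = f x then pmf p y / card (C y) else 0)" .
  qed
  also have "\<dots> = (\<Sum>y\<in>S. \<Sum>x\<in>S. if f x = f y then pmf p y / card (C y) else 0)"
    by (subst sum.swap) (simp add: eq_commute)
  also have "\<dots> = (\<Sum>y\<in>S. \<Sum>x\<in>C y. pmf p y / card (C y))"
    unfolding C_def using S(1) by (simp only: sum.inter_filter)
  also have "\<dots> = (\<Sum>y\<in>S. pmf p y)"
    using card by (intro sum.cong) auto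
  also have "\<dots> = 1" using S by (simp add: sum_pmf_eq_1)
  finally obtain r where r: "\<And>x. pmf r x = (if x \<in> S then w x else 0)"
    using pmf_with_weights[of S w] S pos by (metis less_imp_le)
  show ?thesis
  proof
    have "pmf r x = 0 \<longleftrightarrow> x \<notin> S" for x
      using pos[of x] by (auto simp: r[of x])
    then show "set_pmf r = S"
      by (metis pmf_eq_0_set_pmf set_eqI)
    show "pmf r x = (\<Sum>y | y \<in> S \<and> f y = f x. pmf p y) / card {y \<in> S. f y = f x}" if "x \<in> S" for x
      using that by (simp only: r[of x] w_def[of x] C_def[of x] if_True)
  qed
qed

text \<open>The candidate averages \<open>p\<close> over symbols of equal multiplicity. Its
  chi-square loss is controlled by Cauchy-Schwarz within each class, so only ties contribute. Since
  the support of \<open>p\<close> is exactly the set of seen symbols, unseen ones share probability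
  0.\<close>

lemma best_natural_loss_le_ties:
  fixes p :: "'a pmf"
  assumes n: "0 < n" and xs: "xs \<in> seqs X n" and S: "set_pmf p = set xs" 
    and m: "0 < m" "\<And>x. x \<in> set xs \<Longrightarrow> m \<le> pmf p x"
  shows "best_natural_loss X n p xs
    \<le> ereal ((\<Sum>x\<in>set xs. \<Sum>y\<in>set xs. if count_list xs x = count_list xs y then (pmf p x - pmf p y)\<^sup>2 else 0) / m)"
proof -
  define C where "C x = {y \<in> set xs. count_list xs y = count_list xs x}" for x
  obtain r where r: "set_pmf r = set xs"
    "\<And>x. x \<in> set xs \<Longrightarrow> pmf r x = (\<Sum>y\<in>C x. pmf p y) / card (C x)"
    using class_average[OF finite_set S, of "count_list xs"] unfolding C_def by blast
  have X: "set xs \<subseteq> X" using xs by (auto simp: seqs_def)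
  have card: "card (C x) > 0" if "x \<in> set xs" for x
    using that by (auto simp: card_gt_0_iff C_def)
  have "best_natural_loss X n p xs \<le> KL p r"
  proof (rule best_natural_loss_le[OF n xs])
    fix x y assume eq: "count_list xs x = count_list xs y"
    then have "x \<in> set xs \<longleftrightarrow> y \<in> set xs" by (metis count_list_0_iff)
    moreover have "C x = C y" using eq by (simp add: C_def)
    ultimately show "pmf r x = pmf r y"
      by (metis r pmf_eq_0_set_pmf)
  qed (use r X in auto)
  also have "\<dots> \<le> ereal (\<Sum>x\<in>set xs. (pmf p x - pmf r x)\<^sup>2 / pmf r x)"
    using S r by (intro KL_le_chi_square) auto
  also have "\<dots> \<le> ereal (\<Sum>x\<in>set xs. (\<Sum>y\<in>C x. (pmf p x - pmf p y)\<^sup>2) / m)"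
    unfolding ereal_less_eq
  proof (intro sum_mono frac_le)
    fix x assume x: "x \<in> set xs"
    have "(\<Sum>y\<in>C x. m) \<le> (\<Sum>y\<in>C x. pmf p y)"
      by (intro sum_mono m(2)) (auto simp: C_def)
    then show "m \<le> pmf r x"
      using x card[OF x] by (simp add: r(2) field_simps)
    define c where "c = real (card (C x))"
    have c: "1 \<le> c" using card[OF x] by (simp add: c_def)
    have "pmf p x - pmf r x = (\<Sum>y\<in>C x. pmf p x - pmf p y) / c"
      using x card[OF x] by (simp add: r(2) sum_subtractf diff_divide_distrib c_def)
    then have "(pmf p x - pmf r x)\<^sup>2 = (\<Sum>y\<in>C x. pmf p x - pmf p y)\<^sup>2 / c\<^sup>2"
      by (simp add: power_divide)
    also have "\<dots> \<le> ((\<Sum>y\<in>C x. (pmf p x - pmf p y)\<^sup>2) * c) / c\<^sup>2"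
      unfolding c_def by (intro divide_right_mono sum_squared_le_sum_of_squares) (auto simp: C_def)
    also have "\<dots> = (\<Sum>y\<in>C x. (pmf p x - pmf p y)\<^sup>2) / c"
      using c by (simp add: power2_eq_square)
    also have "\<dots> \<le> (\<Sum>y\<in>C x. (pmf p x - pmf p y)\<^sup>2) / 1"
      using c by (intro divide_left_mono sum_nonneg) auto
    finally show "(pmf p x - pmf r x)\<^sup>2 \<le> (\<Sum>y\<in>C x. (pmf p x - pmf p y)\<^sup>2)" by simp
  qed (use m in \<open>auto intro: sum_nonneg\<close>)
  also have "(\<Sum>x\<in>set xs. (\<Sum>y\<in>C x. (pmf p x - pmf p y)\<^sup>2) / m)
      = (\<Sum>x\<in>set xs. \<Sum>y\<in>set xs. if count_list xs x = count_list xs y then (pmf p x - pmf p y)\<^sup>2 else 0) / m"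
    by (simp add: sum_divide_distrib[symmetric] C_def sum.inter_filter eq_commute)
  finally show ?thesis .
qed

section \<open>Two candidate distributions for bounded sample sizes\<close>

text \<open>Only the constant sample is inspected, and \<open>q\<close> is the estimate there. The
  candidates are the point mass at \<open>a\<close> and a distribution moving mass
  \<open>\<epsilon>\<close> evenly to the rest of \<open>X\<close>. Both are constant off
  \<open>a\<close>, so the natural loss is at most 0, and \<open>q\<close> cannot be near
  both.\<close>

lemma two_point_lower_bound:
  fixes X :: "'a set"
  assumes X: "finite X" "2 \<le> card X" "a \<in> X" and n: "0 < n"
  obtains p where "set_pmf p \<subseteq> X" "9 / 10 \<le> pmf (replicate_pmf n p) (replicate n a)"
    "best_natural_loss X n p (replicate n a) \<le> 0" "ereal (1 / (200 * real n)) \<le> KL p q"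
proof -
  \<comment> \<open>By Bernoulli's inequality the constant sample keeps probability at least
    \<open>1 - n * \<epsilon> = 19 / 20\<close> under the perturbed candidate.\<close>
  define \<epsilon> where "\<epsilon> = 1 / (20 * real n)"
  have \<epsilon>: "0 < \<epsilon>" "\<epsilon> \<le> 1" "real n * \<epsilon> = 1 / 20" "1 / (200 * real n) = \<epsilon> / 10"
    using n by (auto simp: \<epsilon>_def field_simps)
  have xs: "replicate n a \<in> seqs X n" using X by (auto simp: seqs_def)
  have count: "count_list (replicate n a) x = (if x = a then n else 0)" for x
    by (induction n) auto
  have KL_self: "KL p p \<le> 0" if "set_pmf p \<subseteq> X" for p
    using KL_le_chi_square[of "set_pmf p" p p] that finite_subset[OF that X(1)] by (simp add: zero_ereal_def)
  have prob: "pmf (replicate_pmf n p) (replicate n a) = pmf p a ^ n" for p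
    by (simp add: pmf_replicate_pmf prod_list_replicate)
  show ?thesis
  proof (cases "pmf q a \<le> 1 - \<epsilon> / 10")
    case True
    show ?thesis
    proof (rule that[of "return_pmf a"])
      show "set_pmf (return_pmf a) \<subseteq> X" using X by simp
      have "best_natural_loss X n (return_pmf a) (replicate n a) \<le> KL (return_pmf a) (return_pmf a)"
        using X n xs by (intro best_natural_loss_le) (auto simp: count split: if_splits)
      also have "\<dots> \<le> 0" using X by (intro KL_self) auto
      finally show "best_natural_loss X n (return_pmf a) (replicate n a) \<le> 0" .
      \<comment> \<open>The mass of at least \<open>\<epsilon> / 10\<close> that \<open>q\<close>
        puts off \<open>a\<close> already suffices.\<close>
      have "ereal (1 / (200 * real n)) \<le> ereal ((\<Sum>x\<in>{a}. (sqrt (pmf (return_pmf a) x) - sqrt (pmf q x))\<^sup>2)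
          + (1 - (\<Sum>x\<in>{a}. pmf q x)))"
        using True \<epsilon> by (simp add: add_increasing)
      also have "\<dots> \<le> KL (return_pmf a) q" by (intro KL_ge_hellinger) auto
      finally show "ereal (1 / (200 * real n)) \<le> KL (return_pmf a) q" .
    qed (simp add: prob)
  next
    case False
    define w where "w x = (if x = a then 1 - \<epsilon> else \<epsilon> / card (X - {a}))" for x
    have card: "card (X - {a}) > 0" using X by simp
    have sumw: "(\<Sum>x\<in>X - {a}. w x) = \<epsilon>" using card by (simp add: w_def)
    then have "(\<Sum>x\<in>X. w x) = 1" using X by (simp add: sum.remove[of X a] w_def)
    moreover have "0 \<le> w x" for x using \<epsilon> by (simp add: w_def)
    ultimately obtain p where p: "\<And>x. pmf p x = (if x \<in> X then w x else 0)"
      using pmf_with_weights[of X w] X by blast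
    have sub: "set_pmf p \<subseteq> X" by (auto simp: set_pmf_iff p split: if_splits)
    show ?thesis
    proof (rule that[OF sub])
      have "1 + real n * (- \<epsilon>) \<le> (1 + - \<epsilon>) ^ n"
        using \<epsilon> by (intro Bernoulli_inequality) auto
      then show "9 / 10 \<le> pmf (replicate_pmf n p) (replicate n a)"
        unfolding prob p w_def using X \<epsilon> by simp
      have "best_natural_loss X n p (replicate n a) \<le> KL p p"
        using X n xs sub by (intro best_natural_loss_le) (auto simp: count p w_def split: if_splits)
      also have "\<dots> \<le> 0" using sub by (rule KL_self)
      finally show "best_natural_loss X n p (replicate n a) \<le> 0" .
      have sumq: "pmf q a + (\<Sum>x\<in>X - {a}. pmf q x) \<le> 1"
        using measure_measure_pmf_finite[OF X(1), of q] measure_pmf.prob_le_1[of q X] X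
        by (simp add: sum.remove[of X a])
      have "\<epsilon> / 2 - \<epsilon> / 10 \<le> \<epsilon> / 2 - (\<Sum>x\<in>X - {a}. pmf q x)"
        using False sumq by simp
      also have "\<dots> = (\<Sum>x\<in>X - {a}. pmf p x / 2 - pmf q x)"
        using sumw by (simp add: sum_subtractf p flip: sum_divide_distrib)
      also have "\<dots> \<le> (\<Sum>x\<in>X - {a}. (sqrt (pmf p x) - sqrt (pmf q x))\<^sup>2)"
      proof (rule sum_mono)
        fix x
        \<comment> \<open>The factor 2 is chosen to bound the cross term by
          \<open>pmf p x / 2 + 2 * pmf q x\<close>, so that half the mass of \<open>p\<close>
          survives.\<close>
        have "0 \<le> (sqrt (pmf p x) - 2 * sqrt (pmf q x))\<^sup>2" by simp
        also have "\<dots> = pmf p x + 4 * pmf q x - 4 * (sqrt (pmf p x) * sqrt (pmf q x))"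
          by (simp add: power2_diff power_mult_distrib)
        finally show "pmf p x / 2 - pmf q x \<le> (sqrt (pmf p x) - sqrt (pmf q x))\<^sup>2"
          by (simp add: power2_diff)
      qed
      also have "\<dots> \<le> (\<Sum>x\<in>X. (sqrt (pmf p x) - sqrt (pmf q x))\<^sup>2)"
        using X by (intro sum_mono2) auto
      finally have "ereal (1 / (200 * real n)) \<le> ereal ((\<Sum>x\<in>X. (sqrt (pmf p x) - sqrt (pmf q x))\<^sup>2)
          + (1 - (\<Sum>x\<in>X. pmf q x)))"
        using \<epsilon> sumq X by (simp add: sum.remove[of X a])
      also have "\<dots> \<le> KL p q" using X sub by (intro KL_ge_hellinger)
      finally show "ereal (1 / (200 * real n)) \<le> KL p q" .
    qed
  qed
qed

section \<open>Profiles and elementary estimates\<close>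

lemma profile_dim_eq: "profile_dim xs = card (count_list xs ` set xs)"
  by (simp add: profile_dim_def profile_def)

text \<open>When a new maximum \<open>b\<close> is inserted, the old set lies in
  \<open>{1..<b}\<close>, so \<open>b\<close> is at least the new cardinality.\<close>

lemma card_le_sum_positive:
  fixes N :: "nat set"
  assumes "finite N" "0 \<notin> N"
  shows "card N * (card N + 1) \<le> 2 * \<Sum>N"
  using assms
proof (induction N rule: finite_linorder_max_induct)
  case (insert b N)
  have "N \<subseteq> {1..<b}" using insert by (auto simp: Suc_le_eq intro: gr0I)
  then have "card N \<le> card {1..<b}" by (rule card_mono[rotated]) simp
  moreover have "b \<noteq> 0" using insert by auto
  moreover have "b \<notin> N" using insert by auto
  ultimately show ?case using insert by (auto simp: algebra_simps)
qed simp

text \<open>Distinct multiplicities are distinct positive numbers with sum at most the length. This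
  keeps \<open>D\<close> of order \<open>sqrt n\<close>, which leaves room for order
  \<open>D\<close> light symbols with expected counts of order \<open>D\<close>.\<close>

lemma profile_dim_square_le: "profile_dim xs ^ 2 \<le> 2 * length xs"
proof -
  define N where "N = count_list xs ` set xs"
  have "0 \<notin> N" by (auto simp: N_def count_list_0_iff)
  then have "card N * (card N + 1) \<le> 2 * \<Sum>N" by (intro card_le_sum_positive) (auto simp: N_def)
  also have "\<Sum>N \<le> (\<Sum>x\<in>set xs. count_list xs x)"
    unfolding N_def using sum_image_le[of "set xs" "\<lambda>x. x" "count_list xs"] by simp
  also have "\<dots> = length xs" by (rule sum_count_set) auto
  finally show ?thesis by (simp add: profile_dim_eq N_def power2_eq_square algebra_simps)
qed

lemma profile_dim_le_card: "finite S \<Longrightarrow> set xs \<subseteq> S \<Longrightarrow> profile_dim xs \<le> card S"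
  unfolding profile_dim_eq by (meson card_image_le card_mono finite_subset le_trans)

lemma profile_dim_pos: "xs \<noteq> [] \<Longrightarrow> 0 < profile_dim xs"
  by (simp add: profile_dim_eq card_gt_0_iff)

section \<open>Sums along an arithmetic progression\<close>

text \<open>After multiplication by \<open>h\<close>, each term is at most a difference of
  consecutive values of \<open>1 / (1 + h * m)\<close>, and these telescope.\<close>

lemma sum_inverse_square_le:
  assumes "0 < h"
  shows "(\<Sum>m=1..k. 1 / (1 + h * real m)\<^sup>2) \<le> 1 / (h::real)"
proof -
  have "(\<Sum>m=1..k. h / (1 + h * real m)\<^sup>2) \<le> 1 - 1 / (1 + h * real k)"
  proof (induction k)
    case (Suc k)
    define a where "a = 1 + h * real k"
    have a: "0 < a" using assms by (simp add: a_def add_pos_nonneg)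
    have eq: "1 + h * real (Suc k) = a + h" by (simp add: a_def algebra_simps)
    have "h / (a + h)\<^sup>2 \<le> h / ((a + h) * a)"
      using a assms by (intro divide_left_mono) (auto simp: power2_eq_square)
    also have "\<dots> = 1 / a - 1 / (a + h)"
      using a assms by (simp add: field_simps)
    finally have "h / (a + h)\<^sup>2 \<le> 1 / a - 1 / (a + h)" .
    moreover have "(\<Sum>m=1..Suc k. h / (1 + h * real m)\<^sup>2) = (\<Sum>m=1..k. h / (1 + h * real m)\<^sup>2) + h / (a + h)\<^sup>2"
      unfolding eq[symmetric] by simp
    ultimately show ?case using Suc unfolding eq a_def[symmetric] by linarith
  qed simp
  also have "\<dots> \<le> 1" using assms by simp
  finally have "h * (\<Sum>m=1..k. 1 / (1 + h * real m)\<^sup>2) \<le> 1"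
    by (simp add: sum_distrib_left)
  then show ?thesis using assms by (simp add: field_simps)
qed

lemma sum_inverse_square_distance_le:
  assumes "0 < h" "i < k"
  shows "(\<Sum>j\<in>{..<k} - {i}. 1 / (1 + h * \<bar>real i - real j\<bar>)\<^sup>2) \<le> 2 / (h::real)"
proof -
  define f where "f m = 1 / (1 + h * real m)\<^sup>2" for m
  have split: "{..<k} - {i} = {..<i} \<union> {i<..<k}" using assms by auto
  have "(\<Sum>j\<in>{..<k} - {i}. 1 / (1 + h * \<bar>real i - real j\<bar>)\<^sup>2)
     = (\<Sum>j<i. 1 / (1 + h * \<bar>real i - real j\<bar>)\<^sup>2) + (\<Sum>j\<in>{i<..<k}. 1 / (1 + h * \<bar>real i - real j\<bar>)\<^sup>2)"
    unfolding split by (rule sum.union_disjoint) auto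
  also have "(\<Sum>j<i. 1 / (1 + h * \<bar>real i - real j\<bar>)\<^sup>2) = (\<Sum>m=1..i. f m)"
    by (rule sum.reindex_bij_witness[where i="\<lambda>m. i - m" and j="\<lambda>j. i - j"]) (auto simp: f_def of_nat_diff)
  also have "(\<Sum>j\<in>{i<..<k}. 1 / (1 + h * \<bar>real i - real j\<bar>)\<^sup>2) = (\<Sum>m=1..k - i - 1. f m)"
    by (rule sum.reindex_bij_witness[where i="\<lambda>m. i + m" and j="\<lambda>j. j - i"]) (auto simp: f_def of_nat_diff)
  also have "(\<Sum>m=1..i. f m) + (\<Sum>m=1..k - i - 1. f m) \<le> 1 / h + 1 / h"
    unfolding f_def by (intro add_mono sum_inverse_square_le assms)
  finally show ?thesis by simp
qed

text \<open>Meant for the difference \<open>d\<close> of two amplitudes and its part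
  \<open>e\<close> from the progression. It combines
  \<open>d\<^sup>2 * (1 + d\<^sup>2) \<le> 2 * exp (d\<^sup>2)\<close> with
  \<open>(1 + \<bar>e\<bar>)\<^sup>2 \<le> 6 * (1 + d\<^sup>2)\<close>.\<close>

lemma square_times_exp_le:
  fixes d e :: real
  assumes "\<bar>d - e\<bar> \<le> 1"
  shows "d\<^sup>2 * exp (- d\<^sup>2) \<le> 12 / (1 + \<bar>e\<bar>)\<^sup>2"
proof -
  have "1 + d\<^sup>2 + (d\<^sup>2)\<^sup>2 / 2 \<le> exp (d\<^sup>2)" by (rule exp_lower_Taylor_quadratic) simp
  then have "d\<^sup>2 * (1 + d\<^sup>2) \<le> 2 * exp (d\<^sup>2)" using zero_le_power2[of d] unfolding power2_eq_square[of "d\<^sup>2"] distrib_left by linarith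
  then have 1: "d\<^sup>2 * exp (- d\<^sup>2) * (1 + d\<^sup>2) \<le> 2"
    by (simp add: exp_minus field_simps)
  have "(d - e)\<^sup>2 \<le> 1" using assms by (simp add: abs_le_square_iff[of _ 1, simplified])
  then have "d\<^sup>2 + e\<^sup>2 - 2 * (d * e) \<le> 1" by (simp add: power2_diff)
  moreover have "0 \<le> (2 * d - e)\<^sup>2" by simp
  then have "4 * (d * e) \<le> 4 * d\<^sup>2 + e\<^sup>2" by (simp add: power2_diff power_mult_distrib)
  moreover have "0 \<le> (1 - \<bar>e\<bar>)\<^sup>2" by simp
  then have "2 * \<bar>e\<bar> \<le> 1 + e\<^sup>2" by (simp add: power2_diff)
  moreover have "(1 + \<bar>e\<bar>)\<^sup>2 = 1 + 2 * \<bar>e\<bar> + e\<^sup>2" by (simp add: power2_sum)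
  ultimately have "(1 + \<bar>e\<bar>)\<^sup>2 \<le> 6 * (1 + d\<^sup>2)"
    using zero_le_power2[of d] by argo
  then have "d\<^sup>2 * exp (- d\<^sup>2) * (1 + \<bar>e\<bar>)\<^sup>2 \<le> d\<^sup>2 * exp (- d\<^sup>2) * (6 * (1 + d\<^sup>2))"
    by (intro mult_left_mono) auto
  also have "\<dots> \<le> 12" using 1 by (subst mult.left_commute) linarith
  finally show ?thesis
    by (subst pos_le_divide_eq) (auto simp: add_pos_nonneg)
qed

lemma exp_minus_le_inverse:
  fixes y :: real
  assumes "0 < y"
  shows "exp (- y) \<le> 1 / y"
proof -
  have "y \<le> exp y" using exp_ge_add_one_self[of y] by linarith
  then show ?thesis using assms by (simp add: exp_minus field_simps)
qed

lemma sum_Un_le: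
  fixes f :: "'a \<Rightarrow> real"
  assumes "finite A" "finite B" "\<And>x. x \<in> A \<Longrightarrow> 0 \<le> f x"
  shows "sum f (A \<union> B) \<le> sum f A + sum f B"
proof -
  have "0 \<le> sum f (A \<inter> B)" using assms by (intro sum_nonneg) auto
  then show ?thesis using sum.union_inter[OF assms(1,2), of f] by linarith
qed

lemma sum_UN_le:
  fixes f :: "'a \<Rightarrow> real"
  assumes "finite I" "\<And>i. i \<in> I \<Longrightarrow> finite (A i)" "\<And>i x. i \<in> I \<Longrightarrow> x \<in> A i \<Longrightarrow> 0 \<le> f x"
  shows "sum f (\<Union>i\<in>I. A i) \<le> (\<Sum>i\<in>I. sum f (A i))"
  using assms
proof (induction I rule: finite_induct)
  case (insert i I)
  have "sum f (A i \<union> (\<Union>i\<in>I. A i)) \<le> sum f (A i) + sum f (\<Union>i\<in>I. A i)"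
    using insert by (intro sum_Un_le) auto
  also have "sum f (\<Union>i\<in>I. A i) \<le> (\<Sum>i\<in>I. sum f (A i))"
    by (rule insert.IH) (auto intro: insert.prems)
  finally show ?case using insert by simp
qed simp

text \<open>Resampling one coordinate preserves the uniform average: exchanging its old and new
  value is an involution on the pairs \<open>(t, v)\<close>.\<close>

lemma sum_PiE_average:
  assumes "x \<in> I"
  shows "(\<Sum>t\<in>PiE I (\<lambda>_. V). \<Sum>v\<in>V. f (t(x := v))) = real (card V) * (\<Sum>t\<in>PiE I (\<lambda>_. V). f t)"
proof -
  have "(\<Sum>t\<in>PiE I (\<lambda>_. V). \<Sum>v\<in>V. f (t(x := v))) = (\<Sum>(t, v)\<in>PiE I (\<lambda>_. V) \<times> V. f (t(x := v)))"
    by (rule sum.cartesian_product)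
  also have "\<dots> = (\<Sum>(t, v)\<in>PiE I (\<lambda>_. V) \<times> V. f t)"
    using assms
    by (intro sum.reindex_bij_witness[where i="\<lambda>(t, v). (t(x := v), t x)" and j="\<lambda>(t, v). (t(x := v), t x)"])
      (auto simp: PiE_iff extensional_def)
  also have "\<dots> = (\<Sum>t\<in>PiE I (\<lambda>_. V). \<Sum>v\<in>V. f t)"
    by (rule sum.cartesian_product[symmetric])
  finally show ?thesis by (simp add: sum_distrib_left)
qed

lemma weight_square_divide:
  "(weight v xs)\<^sup>2 / weight w xs = weight (\<lambda>x. (v x)\<^sup>2 / w x :: real) xs"
  by (induction xs) (simp_all add: power_mult_distrib flip: times_divide_times_eq)

section \<open>A random family of distributions\<close>

text \<open>With \<open>K = 3\<close> and \<open>\<theta> = 60\<close>, the average success probability in \<open>selection_bound\<close> is at most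
  \<open>60 / grid + 1 / 80 = 1 / 40\<close>; the bound \<open>K = 3\<close> requires shifts of at most \<open>step * grid = 1 / 5\<close>.\<close>
definition grid :: nat where "grid = 4800"

definition step :: real where "step = 1 / 24000"

lemma step_pos: "0 < step" and step_grid: "step * grid = 1 / 5" and grid_pos: "0 < grid"
  by (simp_all add: step_def grid_def)

text \<open>\<open>z\<close> is the heavy symbol and \<open>\<rho>\<close> ranks the light symbols
  along the progression. Light probabilities are at most \<open>9 * A * k / n\<close>, so the factor
  \<open>288 = 9 * 32\<close> bounds their sum by \<open>1 / 32\<close>.\<close>

locale hard_family =
  fixes I :: "'a set" and z :: 'a and \<rho> :: "'a \<Rightarrow> nat" and k n :: nat and A :: real
  assumes finite_I: "finite I" and z: "z \<notin> I" and \<rho>: "bij_betw \<rho> I {..<k}"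
    and k: "1 \<le> k" and A: "1 \<le> A" and n_large: "288 * A * real k ^ 2 \<le> n"
begin

definition S where "S = insert z I"

definition base :: real where "base = sqrt (A * k)"

definition gap :: real where "gap = base / k"

text \<open>The root of the expected count. In this variance-stabilising coordinate
  \<open>n * (sqrt p - sqrt p')\<^sup>2\<close> is a squared difference, and a shift of fixed small
  size is hard to detect at every light symbol.\<close>

definition amp :: "('a \<Rightarrow> nat) \<Rightarrow> 'a \<Rightarrow> real" where
  "amp t x = base + gap * \<rho> x + step * t x"

definition light :: "('a \<Rightarrow> nat) \<Rightarrow> 'a \<Rightarrow> real" where
  "light t x = (amp t x)\<^sup>2 / n"

definition law :: "('a \<Rightarrow> nat) \<Rightarrow> 'a \<Rightarrow> real" where
  "law t x = (if x = z then 1 - (\<Sum>y\<in>I. light t y) else light t x)"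

definition T where "T = PiE I (\<lambda>_. {..<grid})"

definition good :: "('a \<Rightarrow> nat) \<Rightarrow> 'a list set" where
  "good t = {xs \<in> seqs S n. \<forall>x\<in>I. n * law t x / 4 \<le> count_list xs x \<and> count_list xs x \<le> 4 * (n * law t x)}"

text \<open>The bound of \<open>best_natural_loss_le_ties\<close> without the heavy symbol, which
  never ties on a good sample; \<open>base\<^sup>2 / n\<close> is a lower bound for all
  probabilities.\<close>

definition tie_loss :: "('a \<Rightarrow> nat) \<Rightarrow> 'a list \<Rightarrow> real" where
  "tie_loss t xs = (\<Sum>x\<in>I. \<Sum>y\<in>I - {x}.
     if count_list xs x = count_list xs y then (law t x - law t y)\<^sup>2 else 0) / (base\<^sup>2 / n)"

section \<open>Sizes of the probabilities in the family\<close>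

lemma finite_S: "finite S" and card_I: "card I = k"
  using finite_I bij_betw_same_card[OF \<rho>] by (simp_all add: S_def)

lemma base_sq: "base\<^sup>2 = A * k"
  using A by (simp add: base_def)

lemma base_ge_1: "1 \<le> base"
proof -
  have "1 * 1 \<le> A * k" using A k by (intro mult_mono) auto
  then show ?thesis by (simp add: base_def)
qed

lemma gap_pos: "0 < gap"
  using base_ge_1 k by (simp add: gap_def)

lemma gap_base: "gap * base = A"
proof -
  have "gap * base = base\<^sup>2 / k" by (simp add: gap_def power2_eq_square)
  then show ?thesis using k by (simp add: base_sq)
qed

lemma \<rho>_less: "x \<in> I \<Longrightarrow> \<rho> x < k"
  using \<rho> by (auto simp: bij_betw_def)

lemma n_pos: "0 < real n"
proof -
  have "0 < 288 * A * real k ^ 2" using A k by (intro mult_pos_pos) auto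
  then show ?thesis using n_large by linarith
qed

lemma finite_T: "finite T"
  using finite_I by (auto simp: T_def intro: finite_PiE)

lemma T_nonempty: "0 < card T"
  using grid_pos finite_I by (simp add: T_def card_PiE)

lemma T_upd: "t \<in> T \<Longrightarrow> x \<in> I \<Longrightarrow> v < grid \<Longrightarrow> t(x := v) \<in> T"
  by (auto simp: T_def PiE_iff extensional_def)

lemma step_T:
  assumes "t \<in> T" "x \<in> I"
  shows "0 \<le> step * t x" "step * t x \<le> 1 / 5"
proof -
  have "t x < grid" using assms by (auto simp: T_def)
  then have "step * t x \<le> step * grid" using step_pos by (intro mult_left_mono) auto
  then show "step * t x \<le> 1 / 5" by (simp only: step_grid)
qed (use step_pos in simp)

lemma amp_bounds:
  assumes "t \<in> T" "x \<in> I"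
  shows "base \<le> amp t x" "amp t x \<le> 3 * base"
proof -
  have "gap * \<rho> x \<le> gap * k" using \<rho>_less[OF assms(2)] gap_pos by (intro mult_left_mono) auto
  also have "\<dots> = base" using k by (simp add: gap_def)
  finally show "amp t x \<le> 3 * base"
    using step_T[OF assms] base_ge_1 by (simp add: amp_def)
  show "base \<le> amp t x"
    using step_T[OF assms] gap_pos by (simp add: amp_def)
qed

lemma light_bounds:
  assumes "t \<in> T" "x \<in> I"
  shows "base\<^sup>2 / n \<le> light t x" "light t x \<le> 9 * base\<^sup>2 / n" "0 < light t x"
proof -
  note r = amp_bounds[OF assms]
  have "base\<^sup>2 \<le> (amp t x)\<^sup>2" using r base_ge_1 by (intro power_mono) auto
  then show "base\<^sup>2 / n \<le> light t x" unfolding light_def by (intro divide_right_mono) auto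
  have "(amp t x)\<^sup>2 \<le> (3 * base)\<^sup>2" using r base_ge_1 by (intro power_mono) auto
  then show "light t x \<le> 9 * base\<^sup>2 / n" unfolding light_def
    by (intro divide_right_mono) (auto simp: power_mult_distrib)
  show "0 < light t x" using r base_ge_1 n_pos by (simp add: light_def)
qed

lemma sum_light:
  assumes "t \<in> T"
  shows "(\<Sum>x\<in>I. light t x) \<le> 1 / 32"
proof -
  have "(\<Sum>x\<in>I. light t x) \<le> (\<Sum>x\<in>I. 9 * base\<^sup>2 / n)"
    using light_bounds[OF assms] by (intro sum_mono) auto
  also have "\<dots> = 9 * A * real k ^ 2 / n" unfolding sum_constant card_I base_sq by (simp add: power2_eq_square)
  also have "\<dots> \<le> 1 / 32" using n_pos n_large by (simp add: field_simps)
  finally show ?thesis .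
qed

lemma law_light: "x \<in> I \<Longrightarrow> law t x = light t x"
  using z by (auto simp: law_def)

lemma n_law: "x \<in> I \<Longrightarrow> n * law t x = (amp t x)\<^sup>2"
  using n_pos by (simp add: law_light light_def)

lemma law_z: "t \<in> T \<Longrightarrow> 31 / 32 \<le> law t z"
  using sum_light[of t] by (simp add: law_def)

lemma law_pos: "t \<in> T \<Longrightarrow> x \<in> S \<Longrightarrow> 0 < law t x"
  using law_z[of t] light_bounds[of t x] by (cases "x = z") (auto simp: S_def law_light)

lemma law_le_law_z:
  assumes "t \<in> T" "x \<in> I"
  shows "law t x \<le> law t z"
proof -
  have "light t x \<le> (\<Sum>x\<in>I. light t x)"
    using assms finite_I light_bounds(3)[OF assms(1)]
    by (intro member_le_sum) (auto intro: less_imp_le)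
  then show ?thesis using sum_light[OF assms(1)] assms(2) by (simp add: law_light) (simp add: law_def)
qed

lemma sum_law: "(\<Sum>x\<in>S. law t x) = 1"
proof -
  have "(\<Sum>x\<in>I. law t x) = (\<Sum>x\<in>I. light t x)" by (intro sum.cong law_light refl)
  then show ?thesis using finite_I z by (simp add: S_def law_def)
qed

lemma law_ge: "t \<in> T \<Longrightarrow> x \<in> S \<Longrightarrow> base\<^sup>2 / n \<le> law t x"
proof -
  assume *: "t \<in> T" "x \<in> S"
  from k card_I obtain y where y: "y \<in> I" by fastforce
  from light_bounds(1)[OF *(1) y] law_le_law_z[OF *(1) y] have "base\<^sup>2 / n \<le> law t z"
    by (simp add: law_light[OF y])
  with * light_bounds(1)[of t x] show ?thesis by (auto simp: S_def law_light)
qed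

section \<open>Typical samples and the loss caused by ties\<close>

lemma weight_law_nonneg: "t \<in> T \<Longrightarrow> xs \<in> seqs S n \<Longrightarrow> 0 \<le> weight (law t) xs"
  by (rule weight_nonneg[of S]) (auto intro: less_imp_le law_pos)

lemma good_subset: "good t \<subseteq> seqs S n"
  by (auto simp: good_def)

text \<open>Union bound over the \<open>k\<close> light symbols. Since
  \<open>base\<^sup>2 = A * k\<close>, even the crude \<open>exp (- y) \<le> 1 / y\<close> for each
  of them leaves a total free of \<open>k\<close>.\<close>

lemma not_good_weight:
  assumes t: "t \<in> T"
  shows "(\<Sum>xs\<in>seqs S n - good t. weight (law t) xs) \<le> 5 / A"
proof -
  define U where "U x = {xs \<in> seqs S n. count_list xs x > 4 * (n * law t x)}" for x
  define L where "L x = {xs \<in> seqs S n. count_list xs x < n * law t x / 4}" for x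
  have fin: "finite (U x)" "finite (L x)" for x
    using finite_seqs[OF finite_S] by (simp_all add: U_def L_def)
  have nonneg: "xs \<in> seqs S n \<Longrightarrow> 0 \<le> weight (law t) xs" for xs
    by (rule weight_law_nonneg[OF t])
  have "(\<Sum>xs\<in>seqs S n - good t. weight (law t) xs) \<le> (\<Sum>xs\<in>(\<Union>x\<in>I. U x \<union> L x). weight (law t) xs)"
    using fin finite_I by (intro sum_mono2) (auto simp: U_def L_def good_def not_le intro!: nonneg)
  also have "\<dots> \<le> (\<Sum>x\<in>I. \<Sum>xs\<in>U x \<union> L x. weight (law t) xs)"
    using finite_I fin by (intro sum_UN_le) (auto simp: U_def L_def intro: nonneg)
  also have "\<dots> \<le> (\<Sum>x\<in>I. 5 / base\<^sup>2)"
  proof (rule sum_mono)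
    fix x assume x: "x \<in> I"
    have xS: "x \<in> S" using x by (simp add: S_def)
    have b: "0 < base\<^sup>2" using base_ge_1 by simp
    have r: "base\<^sup>2 \<le> (amp t x)\<^sup>2" using amp_bounds[OF t x] base_ge_1 by (intro power_mono) auto
    have nn: "\<And>x. x \<in> S \<Longrightarrow> 0 \<le> law t x" using law_pos[OF t] by (auto intro: less_imp_le)
    have "(\<Sum>xs\<in>U x. weight (law t) xs) \<le> exp (- (amp t x)\<^sup>2)"
      using count_upper_tail[OF finite_S xS sum_law nn, of n] x by (simp add: U_def n_law)
    also have "\<dots> \<le> exp (- base\<^sup>2)" using r by simp
    also have "\<dots> \<le> 1 / base\<^sup>2" using b by (rule exp_minus_le_inverse)
    finally have 1: "(\<Sum>xs\<in>U x. weight (law t) xs) \<le> 1 / base\<^sup>2" .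
    have "(\<Sum>xs\<in>L x. weight (law t) xs) \<le> exp (- ((amp t x)\<^sup>2 / 4))"
      using count_lower_tail[OF finite_S xS sum_law nn, of n] x by (simp add: L_def n_law)
    also have "\<dots> \<le> exp (- (base\<^sup>2 / 4))" using r by simp
    also have "\<dots> \<le> 1 / (base\<^sup>2 / 4)" using b by (intro exp_minus_le_inverse) simp
    finally have 2: "(\<Sum>xs\<in>L x. weight (law t) xs) \<le> 4 / base\<^sup>2" by simp
    have "(\<Sum>xs\<in>U x \<union> L x. weight (law t) xs) \<le> (\<Sum>xs\<in>U x. weight (law t) xs) + (\<Sum>xs\<in>L x. weight (law t) xs)"
      using fin by (intro sum_Un_le) (auto simp: U_def intro: nonneg)
    with 1 2 show "(\<Sum>xs\<in>U x \<union> L x. weight (law t) xs) \<le> 5 / base\<^sup>2" by simp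
  qed
  also have "\<dots> = 5 / A" using k by (simp add: card_I base_sq)
  finally show ?thesis .
qed

text \<open>The light counts total at most \<open>4 * n / 32\<close>, so \<open>z\<close> takes at
  least seven eighths of the sample.\<close>

lemma good_count:
  assumes t: "t \<in> T" and xs: "xs \<in> good t"
  shows "set xs = S" "x \<in> I \<Longrightarrow> count_list xs x < count_list xs z"
proof -
  have len: "set xs \<subseteq> S" "length xs = n" using xs by (auto simp: good_def seqs_def)
  have low: "0 < count_list xs x" if "x \<in> I" for x
  proof -
    have "0 < n * law t x / 4" using n_pos law_pos[OF t] that by (simp add: S_def)
    also have "\<dots> \<le> count_list xs x" using xs that by (simp add: good_def)
    finally show ?thesis by simp
  qed
  have "real (\<Sum>x\<in>I. count_list xs x) \<le> (\<Sum>x\<in>I. 4 * (n * light t x))"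
    unfolding of_nat_sum using xs by (intro sum_mono) (auto simp: good_def law_light)
  also have "\<dots> = 4 * n * (\<Sum>x\<in>I. light t x)" by (simp add: sum_distrib_left mult.assoc)
  also have "\<dots> \<le> 4 * n * (1 / 32)" by (intro mult_left_mono sum_light t) auto
  finally have le: "real (\<Sum>x\<in>I. count_list xs x) \<le> n / 8" by simp
  have "count_list xs z + (\<Sum>x\<in>I. count_list xs x) = n"
    using sum_count_set[OF len(1) finite_S] finite_I z len(2) by (simp add: S_def)
  then have "real (count_list xs z) + real (\<Sum>x\<in>I. count_list xs x) = n"
    by (metis of_nat_add)
  then have lt: "real (\<Sum>x\<in>I. count_list xs x) < count_list xs z" using le n_pos by linarith
  show "count_list xs x < count_list xs z" if "x \<in> I"
  proof -
    have "count_list xs x \<le> (\<Sum>x\<in>I. count_list xs x)" using that finite_I by (intro member_le_sum) auto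
    then show ?thesis using lt by linarith
  qed
  have "0 < count_list xs z" using lt by linarith
  with low have "x \<in> set xs" if "x \<in> S" for x
    using that by (metis S_def count_list_0_iff insertE less_irrefl)
  with len show "set xs = S" by blast
qed

lemma best_natural_loss_le_tie_loss:
  assumes t: "t \<in> T" and xs: "xs \<in> good t" and X: "S \<subseteq> X" and p: "\<And>x. pmf p x = (if x \<in> S then law t x else 0)"
  shows "best_natural_loss X n p xs \<le> ereal (tie_loss t xs)"
proof -
  note G = good_count[OF t xs]
  have "pmf p x = 0 \<longleftrightarrow> x \<notin> S" for x
    using p[of x] law_pos[OF t, of x] by auto
  then have set_p: "set_pmf p = set xs"
    unfolding G by (metis pmf_eq_0_set_pmf set_eqI)
  have "best_natural_loss X n p xs \<le> ereal ((\<Sum>x\<in>set xs. \<Sum>y\<in>set xs.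
      if count_list xs x = count_list xs y then (pmf p x - pmf p y)\<^sup>2 else 0) / (base\<^sup>2 / n))"
  proof (rule best_natural_loss_le_ties[OF _ _ set_p])
    show "xs \<in> seqs X n" using xs X by (auto simp: good_def seqs_def)
    show "0 < base\<^sup>2 / n" using base_ge_1 n_pos by simp
  qed (use n_pos law_ge[OF t] in \<open>auto simp: p G\<close>)
  also have "(\<Sum>x\<in>set xs. \<Sum>y\<in>set xs. if count_list xs x = count_list xs y then (pmf p x - pmf p y)\<^sup>2 else 0)
     = (\<Sum>x\<in>I. \<Sum>y\<in>I - {x}. if count_list xs x = count_list xs y then (law t x - law t y)\<^sup>2 else 0)"
  proof -
    define f where "f x y = (if count_list xs x = count_list xs y then (pmf p x - pmf p y)\<^sup>2 else 0)" for x y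
    have zero: "f x z = 0" "f z x = 0" "f x x = 0" if "x \<in> S" for x
      using that G(2)[of x] by (auto simp: f_def S_def)
    have "(\<Sum>x\<in>S. \<Sum>y\<in>S. f x y) = (\<Sum>x\<in>I. \<Sum>y\<in>S. f x y)"
      using zero finite_S z by (intro sum.mono_neutral_right) (auto simp: S_def)
    also have "\<dots> = (\<Sum>x\<in>I. \<Sum>y\<in>I - {x}. f x y)"
      using zero finite_S z by (intro sum.cong refl sum.mono_neutral_right) (auto simp: S_def)
    also have "\<dots> = (\<Sum>x\<in>I. \<Sum>y\<in>I - {x}. if count_list xs x = count_list xs y then (law t x - law t y)\<^sup>2 else 0)"
      by (intro sum.cong refl) (auto simp: f_def p S_def)
    finally show ?thesis by (simp add: G(1) f_def)
  qed
  finally show ?thesis by (simp add: tie_loss_def)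
qed

text \<open>With \<open>d\<close> and \<open>u\<close> the difference and sum of the two amplitudes,
  the probabilities differ by \<open>d * u / n\<close>, where \<open>u \<le> 6 * base\<close>. The
  constant is \<open>12 * 36 * 2\<close>.\<close>

lemma tie_term_le:
  assumes t: "t \<in> T" and x: "x \<in> I" and y: "y \<in> I"
  shows "(law t x - law t y)\<^sup>2 * (exp (- (n * (sqrt (law t x) - sqrt (law t y))\<^sup>2)) / sqrt (base\<^sup>2 / 4)) / (base\<^sup>2 / n)
    \<le> 864 / (n * base) * (1 / (1 + gap * \<bar>real (\<rho> x) - real (\<rho> y)\<bar>)\<^sup>2)"
proof -
  define d where "d = amp t x - amp t y"
  define u where "u = amp t x + amp t y"
  have b: "0 < base" using base_ge_1 by simp
  note rx = amp_bounds[OF t x] and ry = amp_bounds[OF t y]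
  have u: "u\<^sup>2 \<le> (6 * base)\<^sup>2" unfolding u_def using rx ry b by (intro power_mono) auto
  have sq: "sqrt (law t v) = amp t v / sqrt n" if "v \<in> I" for v
    using that amp_bounds[OF t that] b by (simp add: law_light light_def real_sqrt_divide)
  have f1: "n * (sqrt (law t x) - sqrt (law t y))\<^sup>2 = d\<^sup>2"
    using n_pos by (simp add: sq x y d_def power_divide flip: diff_divide_distrib)
  have "law t x - law t y = d * u / n"
    unfolding law_light[OF x] law_light[OF y] light_def d_def u_def
    by (simp add: power2_eq_square algebra_simps diff_divide_distrib)
  then have f2: "(law t x - law t y)\<^sup>2 = d\<^sup>2 * u\<^sup>2 / (real n)\<^sup>2"
    by (simp add: power_divide power_mult_distrib)
  have f3: "sqrt (base\<^sup>2 / 4) = base / 2"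
    using b by (simp add: real_sqrt_divide)
  have "(law t x - law t y)\<^sup>2 * (exp (- (n * (sqrt (law t x) - sqrt (law t y))\<^sup>2)) / sqrt (base\<^sup>2 / 4)) / (base\<^sup>2 / n)
      = d\<^sup>2 * u\<^sup>2 / (real n)\<^sup>2 * (exp (- d\<^sup>2) / (base / 2)) / (base\<^sup>2 / n)"
    by (simp only: f1 f2 f3)
  also have "\<dots> = (d\<^sup>2 * exp (- d\<^sup>2)) * u\<^sup>2 * (2 / (n * base ^ 3))"
    using b n_pos by (simp add: field_simps power2_eq_square power3_eq_cube)
  also have "\<dots> \<le> (12 / (1 + \<bar>gap * (real (\<rho> x) - real (\<rho> y))\<bar>)\<^sup>2) * (6 * base)\<^sup>2 * (2 / (n * base ^ 3))"
  proof (intro mult_mono square_times_exp_le u)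
    have "d - gap * (real (\<rho> x) - real (\<rho> y)) = step * t x - step * t y"
      by (simp add: d_def amp_def algebra_simps)
    then show "\<bar>d - gap * (real (\<rho> x) - real (\<rho> y))\<bar> \<le> 1"
      using step_T[OF t x] step_T[OF t y] by linarith
  qed (use b in auto)
  also have "\<dots> = 864 / (n * base) * (1 / (1 + gap * \<bar>real (\<rho> x) - real (\<rho> y)\<bar>)\<^sup>2)"
    using b gap_pos by (simp add: abs_mult power2_eq_square power3_eq_cube)
  finally show ?thesis .
qed

text \<open>Light counts on a good sample are at least \<open>base\<^sup>2 / 4\<close>, so
  \<open>tie_weight_le\<close> applies with this \<open>c\<close>. Summing along the progression
  costs \<open>2 / gap\<close> per symbol, and \<open>gap * base = A\<close> gives the gain of a
  factor \<open>A\<close>.\<close>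

lemma expected_tie_loss:
  assumes t: "t \<in> T"
  shows "(\<Sum>xs\<in>good t. weight (law t) xs * tie_loss t xs) \<le> 1728 * k / (A * n)"
proof -
  have b: "0 < base" using base_ge_1 by simp
  define c where "c = base\<^sup>2 / 4"
  have c: "0 < c" using b by (simp add: c_def)
  define m where "m = base\<^sup>2 / n"
  have m: "0 < m" using b n_pos by (simp add: m_def)
  define D where "D x y = (law t x - law t y)\<^sup>2" for x y
  define E where "E x y = {xs \<in> seqs S n. count_list xs x = count_list xs y \<and> c \<le> 2 * count_list xs x + 1}" for x y
  have nn: "\<And>x. x \<in> S \<Longrightarrow> 0 \<le> law t x" using law_pos[OF t] by (auto intro: less_imp_le)
  have fin: "finite (good t)" "finite (E x y)" for x y
    using finite_subset[OF good_subset finite_seqs[OF finite_S]] finite_seqs[OF finite_S] by (auto simp: E_def)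
  have "(\<Sum>xs\<in>good t. weight (law t) xs * tie_loss t xs)
      = (\<Sum>xs\<in>good t. \<Sum>x\<in>I. \<Sum>y\<in>I - {x}. if count_list xs x = count_list xs y then weight (law t) xs * (D x y / m) else 0)"
    unfolding tie_loss_def D_def[symmetric] m_def[symmetric] sum_divide_distrib sum_distrib_left
    by (intro sum.cong refl) auto
  also have "\<dots> = (\<Sum>x\<in>I. \<Sum>y\<in>I - {x}. \<Sum>xs\<in>good t. if count_list xs x = count_list xs y then weight (law t) xs * (D x y / m) else 0)"
    by (subst sum.swap, rule sum.cong[OF refl], rule sum.swap)
  also have "\<dots> \<le> (\<Sum>x\<in>I. \<Sum>y\<in>I - {x}. 864 / (n * base) * (1 / (1 + gap * \<bar>real (\<rho> x) - real (\<rho> y)\<bar>)\<^sup>2))"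
  proof (intro sum_mono)
    fix x y assume x: "x \<in> I" and y: "y \<in> I - {x}"
    have sub: "{xs \<in> good t. count_list xs x = count_list xs y} \<subseteq> E x y"
    proof
      fix xs assume xs: "xs \<in> {xs \<in> good t. count_list xs x = count_list xs y}"
      have "c \<le> n * law t x / 4"
        using amp_bounds[OF t x] b x by (auto simp: c_def n_law intro!: divide_right_mono power_mono)
      also have "\<dots> \<le> count_list xs x" using xs x unfolding good_def by blast
      finally show "xs \<in> E x y" using xs good_subset by (auto simp: E_def)
    qed
    have "(\<Sum>xs\<in>good t. if count_list xs x = count_list xs y then weight (law t) xs * (D x y / m) else 0)
        = (\<Sum>xs\<in>{xs \<in> good t. count_list xs x = count_list xs y}. weight (law t) xs * (D x y / m))"
      using fin by (intro sum.inter_filter[symmetric])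
    also have "\<dots> = (\<Sum>xs\<in>{xs \<in> good t. count_list xs x = count_list xs y}. weight (law t) xs) * (D x y / m)"
      by (rule sum_distrib_right[symmetric])
    also have "\<dots> \<le> (\<Sum>xs\<in>E x y. weight (law t) xs) * (D x y / m)"
      using m by (intro mult_right_mono sum_mono2 fin sub) (auto simp: E_def D_def intro: weight_law_nonneg[OF t])
    also have "\<dots> \<le> (exp (- (n * (sqrt (law t x) - sqrt (law t y))\<^sup>2)) / sqrt c) * (D x y / m)"
      unfolding E_def using m c x y
      by (intro mult_right_mono tie_weight_le[OF finite_S _ _ _ sum_law nn]) (auto simp: S_def D_def)
    also have "\<dots> = D x y * (exp (- (n * (sqrt (law t x) - sqrt (law t y))\<^sup>2)) / sqrt c) / m"
      by simp
    also have "\<dots> \<le> 864 / (n * base) * (1 / (1 + gap * \<bar>real (\<rho> x) - real (\<rho> y)\<bar>)\<^sup>2)"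
      unfolding D_def c_def m_def using y by (intro tie_term_le t x) auto
    finally show "(\<Sum>xs\<in>good t. if count_list xs x = count_list xs y then weight (law t) xs * (D x y / m) else 0)
      \<le> 864 / (n * base) * (1 / (1 + gap * \<bar>real (\<rho> x) - real (\<rho> y)\<bar>)\<^sup>2)" .
  qed
  also have "\<dots> \<le> (\<Sum>x\<in>I. 864 / (n * base) * (2 / gap))"
  proof (rule sum_mono)
    fix x assume x: "x \<in> I"
    have "bij_betw \<rho> (I - {x}) ({..<k} - {\<rho> x})"
      using \<rho> x by (auto simp: bij_betw_def inj_on_def)
    then have "(\<Sum>y\<in>I - {x}. 1 / (1 + gap * \<bar>real (\<rho> x) - real (\<rho> y)\<bar>)\<^sup>2)
      = (\<Sum>j\<in>{..<k} - {\<rho> x}. 1 / (1 + gap * \<bar>real (\<rho> x) - real j\<bar>)\<^sup>2)"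
      by (rule sum.reindex_bij_betw)
    also have "\<dots> \<le> 2 / gap"
      by (intro sum_inverse_square_distance_le gap_pos \<rho>_less x)
    finally show "(\<Sum>y\<in>I - {x}. 864 / (n * base) * (1 / (1 + gap * \<bar>real (\<rho> x) - real (\<rho> y)\<bar>)\<^sup>2))
       \<le> 864 / (n * base) * (2 / gap)"
      unfolding sum_distrib_left[symmetric] using b by (intro mult_left_mono) auto
  qed
  also have "\<dots> = 1728 * k / (n * (gap * base))"
    by (simp add: card_I mult_ac)
  finally show ?thesis unfolding gap_base by (simp add: mult.commute)
qed

lemma tie_loss_nonneg: "0 \<le> tie_loss t xs"
  unfolding tie_loss_def by (intro divide_nonneg_nonneg sum_nonneg) auto

lemma tie_loss_tail:
  assumes t: "t \<in> T" and a: "0 < a"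
  shows "(\<Sum>xs | xs \<in> good t \<and> a < tie_loss t xs. weight (law t) xs) \<le> 1728 * k / (A * n) / a"
proof -
  have fin: "finite (good t)" by (rule finite_subset[OF good_subset finite_seqs[OF finite_S]])
  have nonneg: "xs \<in> good t \<Longrightarrow> 0 \<le> weight (law t) xs" for xs
    using good_subset by (auto intro: weight_law_nonneg[OF t])
  have "(\<Sum>xs | xs \<in> good t \<and> a < tie_loss t xs. weight (law t) xs)
      \<le> (\<Sum>xs | xs \<in> good t \<and> a < tie_loss t xs. weight (law t) xs * tie_loss t xs / a)"
  proof (rule sum_mono)
    fix xs assume xs: "xs \<in> {xs. xs \<in> good t \<and> a < tie_loss t xs}"
    then have "weight (law t) xs * 1 \<le> weight (law t) xs * (tie_loss t xs / a)"
      using a nonneg by (intro mult_left_mono) auto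
    then show "weight (law t) xs \<le> weight (law t) xs * tie_loss t xs / a" by simp
  qed
  also have "\<dots> \<le> (\<Sum>xs\<in>good t. weight (law t) xs * tie_loss t xs / a)"
    using fin a nonneg tie_loss_nonneg by (intro sum_mono2) (auto intro!: divide_nonneg_pos mult_nonneg_nonneg)
  also have "\<dots> = (\<Sum>xs\<in>good t. weight (law t) xs * tie_loss t xs) / a"
    by (rule sum_divide_distrib[symmetric])
  finally show ?thesis
    using expected_tie_loss[OF t] a by (meson divide_right_mono less_imp_le order_trans)
qed

section \<open>Shifts that the sample does not reveal\<close>

text \<open>A new shift of \<open>x\<close> alters only the probabilities of \<open>x\<close> and
  \<open>z\<close>. The chi-square divergence of one observation is at most
  \<open>2 * (9 / 25) / n\<close>, so by independence the second moment is at most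
  \<open>(1 + 1 / n) ^ n\<close>.\<close>

lemma likelihood_ratio_second_moment:
  assumes t: "t \<in> T" and x: "x \<in> I" and v: "v < grid"
  shows "(\<Sum>xs\<in>seqs S n. (weight (law (t(x := v))) xs)\<^sup>2 / weight (law (t(x := 0))) xs) \<le> 3"
proof -
  define t0 where "t0 = t(x := 0)"
  define t1 where "t1 = t(x := v)"
  have t0: "t0 \<in> T" and t1: "t1 \<in> T" using T_upd[OF t x] v grid_pos by (auto simp: t0_def t1_def)
  define \<delta> where "\<delta> = light t1 x - light t0 x"
  have light_eq: "light t1 y = light t0 y" if "y \<noteq> x" for y
    using that by (simp add: t0_def t1_def light_def amp_def)
  have x1: "law t1 x - law t0 x = \<delta>" using x by (simp add: law_light \<delta>_def)
  have z1: "law t1 z - law t0 z = - \<delta>"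
    using finite_I x light_eq by (simp add: law_def sum.remove[of I x] \<delta>_def)
  have eq: "law t1 y = law t0 y" if "y \<noteq> x" "y \<noteq> z" for y
    using that light_eq by (simp add: law_def)
  have p0: "0 < law t0 y" if "y \<in> S" for y using law_pos[OF t0 that] .
  have xz: "x \<noteq> z" "x \<in> S" "z \<in> S" using x z by (auto simp: S_def)
  have "(\<Sum>y\<in>S. (law t1 y)\<^sup>2 / law t0 y)
      = (\<Sum>y\<in>S. (law t1 y - law t0 y)\<^sup>2 / law t0 y + (2 * law t1 y - law t0 y))"
  proof (rule sum.cong[OF refl])
    fix y assume "y \<in> S"
    then show "(law t1 y)\<^sup>2 / law t0 y = (law t1 y - law t0 y)\<^sup>2 / law t0 y + (2 * law t1 y - law t0 y)"
      using p0[of y] by (simp add: field_simps power2_eq_square)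
  qed
  also have "\<dots> = (\<Sum>y\<in>S. (law t1 y - law t0 y)\<^sup>2 / law t0 y) + 1"
    by (simp add: sum.distrib sum_subtractf sum_law flip: sum_distrib_left)
  also have "(\<Sum>y\<in>S. (law t1 y - law t0 y)\<^sup>2 / law t0 y) = (\<Sum>y\<in>{x, z}. (law t1 y - law t0 y)\<^sup>2 / law t0 y)"
    using finite_S xz eq by (intro sum.mono_neutral_right) auto
  also have "\<dots> = \<delta>\<^sup>2 / law t0 x + \<delta>\<^sup>2 / law t0 z"
    using xz by (simp add: x1 z1)
  also have "\<delta>\<^sup>2 / law t0 z \<le> \<delta>\<^sup>2 / law t0 x"
    using law_le_law_z[OF t0 x] p0 xz by (intro divide_left_mono mult_pos_pos) auto
  also have "\<delta>\<^sup>2 / law t0 x \<le> 9 / 25 / n"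
  proof -
    define r u where "r = amp t0 x" and "u = step * v"
    have r: "1 \<le> r" using amp_bounds[OF t0 x] base_ge_1 by (simp add: r_def)
    have u: "0 \<le> u" "u \<le> 1 / 5" using step_T[OF t1 x] by (simp_all add: u_def t1_def)
    have "amp t1 x = r + u" by (simp add: r_def u_def t0_def t1_def amp_def)
    then have \<delta>: "\<delta> = u * (2 * r + u) / n"
      by (simp add: \<delta>_def light_def power2_eq_square algebra_simps flip: r_def diff_divide_distrib)
    \<comment> \<open>\<open>2 * r + u \<le> 3 * r\<close> because \<open>u \<le> 1 / 5\<close> and
      \<open>1 \<le> r\<close>.\<close>
    have "u * (2 * r + u) / n \<le> 1 / 5 * (3 * r) / n"
      using u r by (intro divide_right_mono mult_mono) auto
    then have "\<delta> \<le> 1 / 5 * (3 * r) / n" by (simp only: \<delta>)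
    moreover have "0 \<le> \<delta>" unfolding \<delta> using u r by simp
    ultimately have "\<delta>\<^sup>2 \<le> (1 / 5 * (3 * r) / n)\<^sup>2" by (intro power_mono)
    also have "\<dots> = 9 / 25 / n * law t0 x"
      by (simp add: law_light[OF x] light_def r_def[symmetric] power2_eq_square)
    finally show ?thesis using p0 xz by (simp add: divide_le_eq)
  qed
  finally have le: "(\<Sum>y\<in>S. (law t1 y)\<^sup>2 / law t0 y) \<le> 1 + 1 / n"
    using n_pos by (simp add: field_simps)
  have "(\<Sum>xs\<in>seqs S n. (weight (law t1) xs)\<^sup>2 / weight (law t0) xs)
      = (\<Sum>y\<in>S. (law t1 y)\<^sup>2 / law t0 y) ^ n"
    unfolding weight_square_divide by (rule sum_weight[OF finite_S])
  also have "\<dots> \<le> exp (1 / n) ^ n"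
  proof (rule power_mono)
    show "(\<Sum>y\<in>S. (law t1 y)\<^sup>2 / law t0 y) \<le> exp (1 / n)"
      using le exp_ge_add_one_self[of "1 / n"] by linarith
    show "0 \<le> (\<Sum>y\<in>S. (law t1 y)\<^sup>2 / law t0 y)"
      using p0 by (intro sum_nonneg) (auto intro!: divide_nonneg_pos)
  qed
  also have "\<dots> = exp 1" using n_pos by (simp flip: exp_of_nat_mult)
  also have "\<dots> \<le> 3" by (rule exp_le)
  finally show ?thesis by (simp add: t0_def t1_def)
qed

text \<open>Given a sample, at most one grid value of \<open>t x\<close> can put \<open>q xs\<close> within half a grid step.\<close>
definition close :: "('a list \<Rightarrow> 'a pmf) \<Rightarrow> ('a \<Rightarrow> nat) \<Rightarrow> 'a \<Rightarrow> 'a list set" where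
  "close q t x = {xs \<in> seqs S n. \<bar>amp t x - sqrt (n * pmf (q xs) x)\<bar> < step / 2}"

text \<open>Resample the shift of \<open>x\<close>. With the other shifts fixed,
  \<open>selection_bound\<close> applies with the law of shift 0 as reference, since two grid values
  both close to the estimate would differ by less than one step.\<close>

lemma average_close_weight:
  assumes x: "x \<in> I"
  shows "(\<Sum>t\<in>T. \<Sum>xs\<in>close q t x. weight (law t) xs) \<le> card T / 40"
proof -
  have fin: "finite (seqs S n)" by (rule finite_seqs[OF finite_S])
  have "real grid * (\<Sum>t\<in>T. \<Sum>xs\<in>close q t x. weight (law t) xs)
      = (\<Sum>t\<in>T. \<Sum>v<grid. \<Sum>xs\<in>close q (t(x := v)) x. weight (law (t(x := v))) xs)"
    unfolding T_def using sum_PiE_average[OF x, of "\<lambda>t. \<Sum>xs\<in>close q t x. weight (law t) xs" "{..<grid}"] by simp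
  also have "\<dots> \<le> (\<Sum>t\<in>T. 60 + card {..<grid} * (3 / (4 * 60)))"
  proof (rule sum_mono)
    fix t assume t: "t \<in> T"
    have t0: "t(x := 0) \<in> T" using T_upd[OF t x] grid_pos by simp
    show "(\<Sum>v<grid. \<Sum>xs\<in>close q (t(x := v)) x. weight (law (t(x := v))) xs) \<le> 60 + card {..<grid} * (3 / (4 * 60))"
    proof (rule selection_bound[where L = "seqs S n" and ?P0.0 = "weight (law (t(x := 0)))"])
      show "0 < weight (law (t(x := 0))) xs" if "xs \<in> seqs S n" for xs
        using that by (intro weight_pos[of S] law_pos[OF t0])
      show "(\<Sum>xs\<in>seqs S n. weight (law (t(x := 0))) xs) \<le> 1"
        by (simp add: sum_weight finite_S sum_law)
      show "(\<Sum>xs\<in>seqs S n. (weight (law (t(x := v))) xs)\<^sup>2 / weight (law (t(x := 0))) xs) \<le> 3"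
        if "v \<in> {..<grid}" for v
        using that by (intro likelihood_ratio_second_moment t x) simp
      show "v = v'" if "xs \<in> close q (t(x := v)) x" "xs \<in> close q (t(x := v')) x" for v v' xs
      proof -
        have "\<bar>amp (t(x := v)) x - amp (t(x := v')) x\<bar> < step"
          using that unfolding close_def mem_Collect_eq by linarith
        then have "step * \<bar>real v - real v'\<bar> < step * 1"
          using step_pos by (simp add: amp_def abs_mult flip: right_diff_distrib)
        then have "\<bar>real v - real v'\<bar> < 1" using step_pos by (simp only: mult_less_cancel_left_pos)
        then show ?thesis by linarith
      qed
    qed (auto simp: fin close_def)
  qed
  also have "\<dots> = card T * 120" by (simp add: grid_def)
  finally show ?thesis by (simp add: grid_def)
qed

definition missed :: "('a list \<Rightarrow> 'a pmf) \<Rightarrow> ('a \<Rightarrow> nat) \<Rightarrow> 'a list set" where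
  "missed q t = {xs \<in> seqs S n. k / 2 \<le> card {x \<in> I. xs \<in> close q t x}}"

text \<open>Markov's inequality for the number of light symbols whose shift is identified.\<close>

lemma missed_weight:
  assumes t: "t \<in> T"
  shows "(\<Sum>xs\<in>missed q t. weight (law t) xs) \<le> 2 / k * (\<Sum>x\<in>I. \<Sum>xs\<in>close q t x. weight (law t) xs)"
proof -
  define N where "N xs = real (card {x \<in> I. xs \<in> close q t x})" for xs
  have fin: "finite (seqs S n)" by (rule finite_seqs[OF finite_S])
  have nonneg: "xs \<in> seqs S n \<Longrightarrow> 0 \<le> weight (law t) xs" for xs
    by (rule weight_law_nonneg[OF t])
  have "(\<Sum>xs\<in>missed q t. weight (law t) xs) \<le> (\<Sum>xs\<in>missed q t. weight (law t) xs * (2 / k * N xs))"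
  proof (rule sum_mono)
    fix xs assume xs: "xs \<in> missed q t"
    then have "1 \<le> 2 / k * N xs" using k by (simp add: missed_def N_def field_simps)
    then have "weight (law t) xs * 1 \<le> weight (law t) xs * (2 / k * N xs)"
      using xs nonneg by (intro mult_left_mono) (auto simp: missed_def)
    then show "weight (law t) xs \<le> weight (law t) xs * (2 / k * N xs)" by simp
  qed
  also have "\<dots> \<le> (\<Sum>xs\<in>seqs S n. weight (law t) xs * (2 / k * N xs))"
    using fin nonneg by (intro sum_mono2) (auto simp: missed_def N_def)
  also have "\<dots> = (\<Sum>xs\<in>seqs S n. \<Sum>x\<in>I. 2 / k * (if xs \<in> close q t x then weight (law t) xs else 0))"
  proof (rule sum.cong[OF refl])
    fix xs
    have "N xs = (\<Sum>x\<in>I. if xs \<in> close q t x then 1 else 0)"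
      using finite_I by (simp add: N_def sum.If_cases Int_def)
    then show "weight (law t) xs * (2 / k * N xs)
        = (\<Sum>x\<in>I. 2 / k * (if xs \<in> close q t x then weight (law t) xs else 0))"
      by (simp add: sum_distrib_left) (intro sum.cong refl, auto)
  qed
  also have "\<dots> = 2 / k * (\<Sum>x\<in>I. \<Sum>xs\<in>seqs S n. if xs \<in> close q t x then weight (law t) xs else 0)"
    by (subst sum.swap) (simp add: sum_distrib_left)
  also have "(\<Sum>x\<in>I. \<Sum>xs\<in>seqs S n. if xs \<in> close q t x then weight (law t) xs else 0)
      = (\<Sum>x\<in>I. \<Sum>xs\<in>close q t x. weight (law t) xs)"
  proof (rule sum.cong[OF refl])
    fix x
    have "seqs S n \<inter> {xs. xs \<in> close q t x} = close q t x" by (auto simp: close_def)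
    then show "(\<Sum>xs\<in>seqs S n. if xs \<in> close q t x then weight (law t) xs else 0)
        = (\<Sum>xs\<in>close q t x. weight (law t) xs)"
      by (simp add: sum.If_cases[OF fin])
  qed
  finally show ?thesis .
qed

text \<open>At least half of the light symbols are off by \<open>step / 2\<close> in amplitude, and
  each adds \<open>step\<^sup>2 / 4 / n\<close> to the Hellinger sum.\<close>

lemma KL_lower_bound:
  assumes t: "t \<in> T" and xs: "xs \<in> seqs S n - missed q t" and p: "\<And>x. pmf p x = (if x \<in> S then law t x else 0)"
  shows "ereal (step\<^sup>2 / 8 * k / n) \<le> KL p (q xs)"
proof -
  define N where "N = {x \<in> I. xs \<in> close q t x}"
  define r where "r = q xs"
  have N: "N \<subseteq> I" "real (card N) < k / 2" using xs by (auto simp: N_def missed_def)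
  have "real (card (I - N)) = real k - real (card N)"
    using N(1) finite_I card_mono[OF finite_I N(1)] by (simp add: card_Diff_subset finite_subset card_I of_nat_diff)
  with N have card: "k / 2 \<le> real (card (I - N))" by simp
  have "step\<^sup>2 / 8 * k / n = k / 2 * (step\<^sup>2 / 4 / n)" by simp
  also have "\<dots> \<le> card (I - N) * (step\<^sup>2 / 4 / n)"
    using card by (intro mult_right_mono) auto
  also have "\<dots> = (\<Sum>x\<in>I - N. step\<^sup>2 / 4 / n)" by simp
  also have "\<dots> \<le> (\<Sum>x\<in>I - N. (sqrt (pmf p x) - sqrt (pmf r x))\<^sup>2)"
  proof (rule sum_mono)
    fix x assume x: "x \<in> I - N"
    then have far: "step / 2 \<le> \<bar>amp t x - sqrt (n * pmf r x)\<bar>"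
      using xs by (auto simp: N_def close_def r_def)
    have "pmf p x = light t x" using x by (simp add: p S_def law_light)
    moreover have "0 \<le> amp t x" using amp_bounds(1)[OF t, of x] x base_ge_1 by auto
    ultimately have "sqrt (pmf p x) = amp t x / sqrt n"
      by (simp add: light_def real_sqrt_divide)
    moreover have "sqrt (pmf r x) = sqrt (n * pmf r x) / sqrt n"
      using n_pos by (simp add: real_sqrt_mult)
    ultimately have "(sqrt (pmf p x) - sqrt (pmf r x))\<^sup>2 = \<bar>amp t x - sqrt (n * pmf r x)\<bar>\<^sup>2 / n"
      using n_pos by (simp add: power_divide flip: diff_divide_distrib)
    moreover have "(step / 2)\<^sup>2 \<le> \<bar>amp t x - sqrt (n * pmf r x)\<bar>\<^sup>2"
      using far step_pos by (intro power_mono) auto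
    then have "(step / 2)\<^sup>2 / n \<le> \<bar>amp t x - sqrt (n * pmf r x)\<bar>\<^sup>2 / n"
      by (rule divide_right_mono) simp
    ultimately show "step\<^sup>2 / 4 / n \<le> (sqrt (pmf p x) - sqrt (pmf r x))\<^sup>2"
      by (simp add: power_divide)
  qed
  also have "\<dots> \<le> (\<Sum>x\<in>S. (sqrt (pmf p x) - sqrt (pmf r x))\<^sup>2)"
    using finite_S by (intro sum_mono2) (auto simp: S_def)
  also have "\<dots> \<le> (\<Sum>x\<in>S. (sqrt (pmf p x) - sqrt (pmf r x))\<^sup>2) + (1 - (\<Sum>x\<in>S. pmf r x))"
    using measure_measure_pmf_finite[OF finite_S, of r] measure_pmf.prob_le_1[of r S] by simp
  finally have "ereal (step\<^sup>2 / 8 * k / n) \<le> ereal ((\<Sum>x\<in>S. (sqrt (pmf p x) - sqrt (pmf r x))\<^sup>2) + (1 - (\<Sum>x\<in>S. pmf r x)))"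
    by simp
  also have "\<dots> \<le> KL p r"
  proof (rule KL_ge_hellinger[OF finite_S])
    have "pmf p x = 0" if "x \<notin> S" for x using that by (simp add: p)
    then show "set_pmf p \<subseteq> S" by (metis set_pmf_iff subsetI)
  qed
  finally show ?thesis by (simp add: r_def)
qed

text \<open>Averaged over \<open>T\<close>, the bad samples have weight at most
  \<open>1 / 20 + 1 / 20\<close>, so some \<open>t\<close> achieves \<open>1 / 10\<close>. The
  natural loss is allowed half of what the estimator must lose, which leaves a difference of order
  \<open>k / n\<close>.\<close>

lemma hard_distribution:
  fixes q :: "'a list \<Rightarrow> 'a pmf"
  assumes A_def: "A = 10 ^ 15" and X: "S \<subseteq> X"
  obtains p where "set_pmf p \<subseteq> S"
    "9 / 10 \<le> measure_pmf.prob (replicate_pmf n p)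
      {xs. set xs \<subseteq> S \<and> best_natural_loss X n p xs \<le> ereal (step\<^sup>2 / 16 * k / n) \<and> ereal (step\<^sup>2 / 8 * k / n) \<le> KL p (q xs)}"
proof -
  define a where "a = step\<^sup>2 / 16 * k / n"
  define costly where "costly t = {xs. xs \<in> good t \<and> a < tie_loss t xs}" for t
  define bad where "bad t = (seqs S n - good t) \<union> costly t \<union> missed q t" for t
  have a: "0 < a" using step_pos k n_pos by (simp add: a_def)
  have fin: "finite (seqs S n)" by (rule finite_seqs[OF finite_S])
  have "finite (seqs S n - good t)" "finite (costly t)" "finite (missed q t)" for t
    using fin finite_subset[OF good_subset fin] by (auto simp: costly_def missed_def)
  note finites = this
  have subsets: "seqs S n - good t \<subseteq> seqs S n" "costly t \<subseteq> seqs S n" "missed q t \<subseteq> seqs S n" for t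
    using good_subset[of t] by (auto simp: costly_def missed_def)
  have bad_weight: "(\<Sum>xs\<in>bad t. weight (law t) xs)
      \<le> 1 / 20 + 2 / k * (\<Sum>x\<in>I. \<Sum>xs\<in>close q t x. weight (law t) xs)" if t: "t \<in> T" for t
  proof -
    have nonneg: "xs \<in> seqs S n \<Longrightarrow> 0 \<le> weight (law t) xs" for xs
      by (rule weight_law_nonneg[OF t])
    have "(\<Sum>xs\<in>bad t. weight (law t) xs) \<le> (\<Sum>xs\<in>(seqs S n - good t) \<union> costly t. weight (law t) xs)
        + (\<Sum>xs\<in>missed q t. weight (law t) xs)"
      unfolding bad_def using finites subsets by (intro sum_Un_le) (blast intro!: nonneg)+
    also have "(\<Sum>xs\<in>(seqs S n - good t) \<union> costly t. weight (law t) xs)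
        \<le> (\<Sum>xs\<in>seqs S n - good t. weight (law t) xs) + (\<Sum>xs\<in>costly t. weight (law t) xs)"
      using finites by (intro sum_Un_le) (blast intro!: nonneg)+
    also have "(\<Sum>xs\<in>seqs S n - good t. weight (law t) xs) \<le> 5 / A"
      by (rule not_good_weight[OF t])
    also have "(\<Sum>xs\<in>costly t. weight (law t) xs) \<le> 1728 * k / (A * n) / a"
      unfolding costly_def by (rule tie_loss_tail[OF t a])
    \<comment> \<open>The ratio \<open>k / n\<close> cancels. As
      \<open>1728 * 16 / step\<^sup>2\<close> is below \<open>2 * 10 ^ 13\<close>, the value
      \<open>10 ^ 15\<close> of \<open>A\<close> is large enough.\<close>
    also have "5 / A + 1728 * k / (A * n) / a \<le> 1 / 20"
      using k n_pos by (simp add: A_def a_def step_def power2_eq_square)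
    also have "(\<Sum>xs\<in>missed q t. weight (law t) xs) \<le> 2 / k * (\<Sum>x\<in>I. \<Sum>xs\<in>close q t x. weight (law t) xs)"
      by (rule missed_weight[OF t])
    finally show ?thesis by simp
  qed
  have "(\<Sum>t\<in>T. \<Sum>xs\<in>bad t. weight (law t) xs)
      \<le> (\<Sum>t\<in>T. 1 / 20 + 2 / k * (\<Sum>x\<in>I. \<Sum>xs\<in>close q t x. weight (law t) xs))"
    by (intro sum_mono bad_weight)
  also have "\<dots> = card T / 20 + 2 / k * (\<Sum>x\<in>I. \<Sum>t\<in>T. \<Sum>xs\<in>close q t x. weight (law t) xs)"
    unfolding sum.distrib sum_distrib_left[symmetric] by (subst sum.swap) simp
  also have "\<dots> \<le> card T / 20 + 2 / k * (\<Sum>x\<in>I. card T / 40)"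
    by (intro add_left_mono mult_left_mono sum_mono average_close_weight) auto
  also have "\<dots> = (\<Sum>t\<in>T. 1 / 10)" using k by (simp add: card_I)
  finally have "(\<Sum>t\<in>T. \<Sum>xs\<in>bad t. weight (law t) xs) \<le> (\<Sum>t\<in>T. 1 / 10)" .
  moreover have "(\<Sum>t\<in>T. 1 / 10) < (\<Sum>t\<in>T. \<Sum>xs\<in>bad t. weight (law t) xs)"
    if "\<And>t. t \<in> T \<Longrightarrow> 1 / 10 < (\<Sum>xs\<in>bad t. weight (law t) xs)"
    using T_nonempty that by (intro sum_strict_mono finite_T) auto
  ultimately obtain t where t: "t \<in> T" and bad: "(\<Sum>xs\<in>bad t. weight (law t) xs) \<le> 1 / 10"
    by (meson not_le)
  obtain p where p: "\<And>x. pmf p x = (if x \<in> S then law t x else 0)"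
    using pmf_with_weights[OF finite_S less_imp_le[OF law_pos[OF t]] sum_law] by blast
  have "pmf p x = 0" if "x \<notin> S" for x using that by (simp add: p)
  then have sub: "set_pmf p \<subseteq> S" by (metis set_pmf_iff subsetI)
  define E where "E = {xs. set xs \<subseteq> S \<and> best_natural_loss X n p xs \<le> ereal a \<and> ereal (step\<^sup>2 / 8 * k / n) \<le> KL p (q xs)}"
  have "xs \<in> E" if xs: "xs \<in> seqs S n - bad t" for xs
  proof -
    have "xs \<in> good t" "\<not> a < tie_loss t xs" "xs \<in> seqs S n - missed q t"
      using xs by (auto simp: bad_def costly_def)
    moreover from this have "best_natural_loss X n p xs \<le> ereal a"
      using best_natural_loss_le_tie_loss[OF t _ X p, of xs] by (meson ereal_less_eq(3) not_le order_trans)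
    ultimately show ?thesis
      using KL_lower_bound[OF t _ p, of xs q] by (auto simp: E_def seqs_def)
  qed
  then have sub_bad: "seqs S n - E \<subseteq> bad t" by blast
  have "(\<Sum>xs\<in>seqs S n - E. weight (pmf p) xs) = (\<Sum>xs\<in>seqs S n - E. weight (law t) xs)"
    by (intro sum.cong refl arg_cong[of _ _ prod_list] map_cong) (auto simp: seqs_def p)
  also have "\<dots> \<le> (\<Sum>xs\<in>bad t. weight (law t) xs)"
    using finites subsets unfolding bad_def
    by (intro sum_mono2 sub_bad[unfolded bad_def]) (blast intro!: weight_law_nonneg[OF t])+
  finally have "9 / 10 \<le> measure_pmf.prob (replicate_pmf n p) E"
    using bad prob_replicate_pmf[OF finite_S sub, of n E] by simp
  then show ?thesis using that[OF sub] by (simp add: E_def a_def)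
qed

end

section \<open>Choice of the parameters for given \<open>n\<close> and \<open>D\<close>\<close>

lemma ereal_diff_ge:
  assumes "b \<le> ereal v" "ereal u \<le> a" "w \<le> u - v"
  shows "ereal w \<le> a - b"
proof -
  have "ereal w \<le> ereal u - ereal v" using assms by simp
  also have "\<dots> \<le> a - b" using assms by (intro ereal_minus_mono)
  finally show ?thesis .
qed

(* Every finite or countably infinite alphabet is, up to renaming, a set X of naturals; working
   over one type makes the constants C, c, n0 absolute. The number D ranges over the values that
   the profile dimension of a sequence of length n over X can take. The best natural loss is
   required to be finite, so that the difference of losses is never infinity - infinity. *)
theorem theorem5:
  shows "\<exists>(C::real) (c::real) (n0::nat). C > 0 \<and> c > 0 \<and>
    (\<forall>(X::nat set) (n::nat) (D::nat) (q'::nat list \<Rightarrow> nat pmf).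
       n > 0 \<longrightarrow>
       (finite X \<and> card X \<ge> 2) \<or> (infinite X \<and> n \<ge> n0) \<longrightarrow>
       D \<in> profile_dim ` seqs X n \<longrightarrow>
       estimator X n q' \<longrightarrow>
       (\<exists>p::nat pmf. set_pmf p \<subseteq> X \<and>
          measure_pmf.prob (replicate_pmf n p)
            {xs. C * (ln (real n) + real D) \<ge> real (profile_dim xs) \<and>
                 best_natural_loss X n p xs < \<infinity> \<and>
                 KL p (q' xs) - best_natural_loss X n p xs \<ge> ereal (c * (real D / real n))}
          \<ge> 9 / 10))"
proof (rule exI[of _ 2], rule exI[of _ "1 / 10 ^ 20"], rule exI[of _ "288 * 10 ^ 15"], intro conjI allI impI)
  fix X :: "nat set" and n D :: nat and q' :: "nat list \<Rightarrow> nat pmf"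
  assume n: "0 < n" and X: "(finite X \<and> card X \<ge> 2) \<or> (infinite X \<and> n \<ge> 288 * 10 ^ 15)"
    and D: "D \<in> profile_dim ` seqs X n"
  obtain ys where ys: "set ys \<subseteq> X" "length ys = n" "D = profile_dim ys"
    using D by (auto simp: seqs_def)
  have D_pos: "0 < D" using ys n profile_dim_pos[of ys] by auto
  have D_sq: "D ^ 2 \<le> 2 * n" using profile_dim_square_le[of ys] ys by simp
  have D_card: "finite X \<Longrightarrow> D \<le> card X" using profile_dim_le_card[of X ys] ys by simp
  have ln_n: "0 \<le> ln (real n)" using n by simp
  let ?E = "\<lambda>p. {xs. 2 * (ln (real n) + real D) \<ge> real (profile_dim xs) \<and>
                 best_natural_loss X n p xs < \<infinity> \<and>
                 KL p (q' xs) - best_natural_loss X n p xs \<ge> ereal (1 / 10 ^ 20 * (real D / real n))}"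
  show "\<exists>p. set_pmf p \<subseteq> X \<and> measure_pmf.prob (replicate_pmf n p) (?E p) \<ge> 9 / 10"
  proof (cases "n < 288 * 10 ^ 15")
    case True
    \<comment> \<open>Below the threshold infinite alphabets are excluded, and \<open>D\<close> is
      bounded through \<open>D\<^sup>2 \<le> 2 * n\<close>.\<close>
    with X have fin: "finite X" "2 \<le> card X" by auto
    then obtain a where a: "a \<in> X" by fastforce
    define xs where "xs = replicate n a"
    obtain p where p: "set_pmf p \<subseteq> X" "9 / 10 \<le> pmf (replicate_pmf n p) xs"
      "best_natural_loss X n p xs \<le> ereal 0" "ereal (1 / (200 * real n)) \<le> KL p (q' xs)"
      using two_point_lower_bound[OF fin a n, of "q' xs"] unfolding xs_def zero_ereal_def by metis
    have "set xs \<subseteq> {a}" by (auto simp: xs_def)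
    then have "profile_dim xs \<le> 1" using profile_dim_le_card[of "{a}" xs] by simp
    moreover have "D ^ 2 \<le> (10 ^ 10) ^ 2" using D_sq True by simp
    then have "D \<le> 10 ^ 10" by (rule power2_le_imp_le) simp
    \<comment> \<open>\<open>D / 10 ^ 20 \<le> 1 / 10 ^ 10\<close>, far below
      \<open>1 / 200\<close>.\<close>
    then have "1 / 10 ^ 20 * (real D / real n) \<le> 1 / (200 * real n) - 0"
      using n by (simp add: field_simps)
    then have "ereal (1 / 10 ^ 20 * (real D / real n)) \<le> KL p (q' xs) - best_natural_loss X n p xs"
      by (rule ereal_diff_ge[OF p(3,4)])
    ultimately have "{xs} \<subseteq> ?E p"
      using D_pos ln_n p(3) by (auto intro: le_less_trans)
    then have "pmf (replicate_pmf n p) xs \<le> measure_pmf.prob (replicate_pmf n p) (?E p)"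
      unfolding measure_pmf_single[symmetric] by (intro measure_pmf.finite_measure_mono) auto
    with p show ?thesis by (intro exI[of _ p]) auto
  next
    case False
    \<comment> \<open>The divisor \<open>10 ^ 9\<close> turns \<open>D\<^sup>2 \<le> 2 * n\<close>
      into the \<open>n_large\<close> condition for \<open>A = 10 ^ 15\<close>, because
      \<open>288 * 10 ^ 15 \<le> 10 ^ 18 / 2\<close>. For \<open>k = 1\<close> that condition is the
      threshold on \<open>n\<close>.\<close>
    define k where "k = max 1 (D div 10 ^ 9)"
    have kD: "1 \<le> k" "D \<le> 2 * 10 ^ 9 * k" "k + 1 \<le> 2 * D" "k + 1 \<le> max 2 D"
      using D_pos by (auto simp: k_def max_def)
    have "288 * 10 ^ 15 * k ^ 2 \<le> n"
    proof (cases "D div 10 ^ 9 \<le> 1")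
      case True
      then show ?thesis using False by (simp add: k_def max_def)
    next
      case large: False
      then have "k * 10 ^ 9 \<le> D" by (simp add: k_def max_def)
      then have "(k * 10 ^ 9) ^ 2 \<le> D ^ 2" by (rule power_mono) simp
      with D_sq show ?thesis by (simp add: power_mult_distrib)
    qed
    then have "real (288 * 10 ^ 15 * k ^ 2) \<le> real n" by (rule of_nat_mono)
    then have n_large: "288 * 10 ^ 15 * real k ^ 2 \<le> real n" by simp
    \<comment> \<open>A finite alphabet has at least \<open>max 2 D\<close> symbols, enough for
      \<open>k\<close> light ones and the heavy one.\<close>
    obtain S where S: "finite S" "S \<subseteq> X" "card S = k + 1"
    proof (cases "finite X")
      case True
      with X kD D_card have "k + 1 \<le> card X" by auto
      then show ?thesis using that by (metis obtain_subset_with_card_n)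
    next
      case False
      then show ?thesis using that by (metis infinite_arbitrarily_large)
    qed
    then obtain z where z: "z \<in> S" by fastforce
    define I where "I = S - {z}"
    have I: "finite I" "card I = k" "insert z I = S" using S z by (auto simp: I_def)
    then obtain \<rho> where \<rho>: "bij_betw \<rho> I {..<k}"
      using ex_bij_betw_finite_nat[of I] by (auto simp: atLeast0LessThan)
    interpret hard_family I z \<rho> k n "10 ^ 15"
      using I \<rho> kD n_large by unfold_locales (auto simp: I_def)
    have S_eq: "hard_family.S I z = S" using I by (simp add: S_def)
    obtain p where p: "set_pmf p \<subseteq> S" "9 / 10 \<le> measure_pmf.prob (replicate_pmf n p)
      {xs. set xs \<subseteq> S \<and> best_natural_loss X n p xs \<le> ereal (step\<^sup>2 / 16 * k / n) \<and> ereal (step\<^sup>2 / 8 * k / n) \<le> KL p (q' xs)}"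
      (is "_ \<le> measure_pmf.prob _ ?F")
      using hard_distribution[of X q'] S unfolding S_eq by blast
    have "?F \<subseteq> ?E p"
    proof
      fix xs assume xs: "xs \<in> ?F"
      then have "profile_dim xs \<le> 2 * D" using profile_dim_le_card[of S xs] S kD(3) by simp
      then have "real (profile_dim xs) \<le> 2 * (ln (real n) + real D)" using ln_n by simp
      moreover have "real D \<le> real (2 * 10 ^ 9 * k)" using kD(2) by (rule of_nat_mono)
      \<comment> \<open>\<open>step\<^sup>2 / 16\<close> exceeds \<open>1 / 10 ^ 10\<close> and
        \<open>k\<close> is at least \<open>D / (2 * 10 ^ 9)\<close>, so the product is more than
        \<open>D / 10 ^ 20\<close>.\<close>
      then have "1 / 10 ^ 20 * (real D / real n) \<le> step\<^sup>2 / 8 * k / n - step\<^sup>2 / 16 * k / n"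
        using n by (simp add: step_def power2_eq_square field_simps)
      then have "ereal (1 / 10 ^ 20 * (real D / real n)) \<le> KL p (q' xs) - best_natural_loss X n p xs"
        using xs by (intro ereal_diff_ge) auto
      ultimately show "xs \<in> ?E p" using xs by (auto intro: le_less_trans)
    qed
    then have "measure_pmf.prob (replicate_pmf n p) ?F \<le> measure_pmf.prob (replicate_pmf n p) (?E p)"
      by (intro measure_pmf.finite_measure_mono) auto
    with p S show ?thesis by (intro exI[of _ p]) auto
  qed
qed simp_all

end
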